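(* For any given weighted rooted tree $L$, the proportion of weighted (unrooted) trees of total weight $n$ that have $L$ as a limb approaches $1$ as $n\to\infty$.
   Context: A weighted tree is a finite (unrooted) tree in which each vertex is assigned a positive integer weight; a weighted rooted tree is such a tree with a distinguished root vertex. The total weight is the sum of the weights of all vertices. Weighted trees are counted up to weight-preserving isomorphism; there are finitely many of each total weight $n$. Let $T$ be a weighted tree and $v\in V(T)$. A branch at $v$ is a maximal subtree of $T$ in which $v$ has degree $1$ (with weights inherited from $T$). A limb at $v$ is the weighted rooted subtree, with root $v$, formed by a (possibly empty) collection of branches at $v$. The tree $T$ has $L$ as a limb if for some $v\in V(T)$ there is a limb at $v$ isomorphic to $L$ as a weighted rooted tree (isomorphism preserving root and weights). *)

theory Defs
  imports Complex_Main "Graph_Theory.Graph_Theory"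
begin

text \<open>
  Undirected simple graphs are symmetric loop-free digraphs. The constant \<open>tree\<close> of the
  library cannot be used for them: its \<open>forest\<close> forbids every directed cycle, and already
  the two arcs of an undirected edge form one. The cycles of an undirected simple graph are
  the directed cycles of length at least 3. \<open>connected\<close> entails non-emptiness.
\<close>

definition undirected_tree :: "('a, 'b) pre_digraph \<Rightarrow> bool" where
  "undirected_tree G \<longleftrightarrow>
     graph G \<and> Digraph_Component.connected G \<and>
     \<not> (\<exists>p. pre_digraph.cycle G p \<and> 3 \<le> length p)"

record 'a weighted_graph =
  skeleton :: "'a pair_pre_digraph"
  weight :: "'a \<Rightarrow> nat"

abbreviation vertices :: "'a weighted_graph \<Rightarrow> 'a set" where
  "vertices T \<equiv> pverts (skeleton T)"

text \<open>Values of \<open>weight\<close> outside \<open>vertices\<close> are irrelevant.\<close>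

definition weighted_tree :: "'a weighted_graph \<Rightarrow> bool" where
  "weighted_tree T \<longleftrightarrow>
     undirected_tree (with_proj (skeleton T)) \<and> (\<forall>v \<in> vertices T. 0 < weight T v)"

definition weighted_rooted_tree :: "'a weighted_graph \<Rightarrow> 'a \<Rightarrow> bool" where
  "weighted_rooted_tree T r \<longleftrightarrow> weighted_tree T \<and> r \<in> vertices T"

definition total_weight :: "'a weighted_graph \<Rightarrow> nat" where
  "total_weight T = (\<Sum>v \<in> vertices T. weight T v)"

definition weighted_isomorphism ::
  "('a, 'a \<times> 'a, 'b, 'b \<times> 'b) digraph_isomorphism \<Rightarrow>
   'a weighted_graph \<Rightarrow> 'b weighted_graph \<Rightarrow> bool" where
  "weighted_isomorphism h S T \<longleftrightarrow>
     pre_digraph.digraph_isomorphism (with_proj (skeleton S)) h \<and>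
     with_proj (skeleton T) = app_iso h (with_proj (skeleton S)) \<and>
     (\<forall>v \<in> vertices S. weight T (iso_verts h v) = weight S v)"

definition weighted_iso :: "'a weighted_graph \<Rightarrow> 'b weighted_graph \<Rightarrow> bool" where
  "weighted_iso S T \<longleftrightarrow> (\<exists>h. weighted_isomorphism h S T)"

definition rooted_weighted_iso ::
  "'a weighted_graph \<Rightarrow> 'a \<Rightarrow> 'b weighted_graph \<Rightarrow> 'b \<Rightarrow> bool" where
  "rooted_weighted_iso S r T s \<longleftrightarrow> (\<exists>h. weighted_isomorphism h S T \<and> iso_verts h r = s)"

text \<open>The degree of a vertex of an undirected graph is its out-degree as a symmetric digraph.\<close>

definition branches :: "'a weighted_graph \<Rightarrow> 'a \<Rightarrow> 'a pair_pre_digraph set" where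
  "branches T v =
     {B. pre_digraph.max_subgraph (with_proj (skeleton T))
           (\<lambda>H. undirected_tree H \<and> v \<in> verts H \<and> out_degree H v = 1) (with_proj B)}"

text \<open>The limb formed by a collection \<open>\<B>\<close> of branches; if \<open>\<B>\<close> is empty, only the root is left.\<close>

definition limb :: "'a weighted_graph \<Rightarrow> 'a \<Rightarrow> 'a pair_pre_digraph set \<Rightarrow> 'a weighted_graph" where
  "limb T v \<B> =
     \<lparr>skeleton = \<lparr>pverts = insert v (\<Union>B \<in> \<B>. pverts B), parcs = (\<Union>B \<in> \<B>. parcs B)\<rparr>,
      weight = weight T\<rparr>"

definition has_limb :: "'a weighted_graph \<Rightarrow> 'b weighted_graph \<Rightarrow> 'b \<Rightarrow> bool" where
  "has_limb T L r \<longleftrightarrow>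
     (\<exists>v \<in> vertices T. \<exists>\<B> \<subseteq> branches T v. rooted_weighted_iso (limb T v \<B>) v L r)"

text \<open>
  Every finite weighted tree is isomorphic to one whose vertices are natural numbers, so
  the isomorphism classes are taken there.
\<close>

definition weighted_trees_of_weight :: "nat \<Rightarrow> nat weighted_graph set" where
  "weighted_trees_of_weight n = {T. weighted_tree T \<and> total_weight T = n}"

definition unlabelled_weighted_trees :: "nat \<Rightarrow> nat weighted_graph set set" where
  "unlabelled_weighted_trees n =
     weighted_trees_of_weight n //
       {(S, T) \<in> weighted_trees_of_weight n \<times> weighted_trees_of_weight n. weighted_iso S T}"

definition limb_proportion :: "'b weighted_graph \<Rightarrow> 'b \<Rightarrow> nat \<Rightarrow> real" where
  "limb_proportion L r n =
     real (card {C \<in> unlabelled_weighted_trees n. \<exists>T \<in> C. has_limb T L r}) /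
     real (card (unlabelled_weighted_trees n))"

end

(*
  Rooting costs at most a factor n: a rooted tree of weight n comes from exactly one unrooted tree, and
  an unrooted tree has at most n vertices to root it at. So it suffices that rooted trees avoiding L as
  a limb below some vertex become rarer than 1/n among all rooted trees, and they do so exponentially.

  Let R(x) and A(x) be the generating functions of all and of the L-avoiding rooted trees, and let l be
  the weight of L. A rooted tree is a root weight together with a multiset of rooted trees, hence
  R(x) = x / (1 - x) * exp (R(x)) * E(x), where E still converges beyond the radius of convergence rho
  of R. Since R * exp (- R) <= exp (- 1), also rho / (1 - rho) * E(rho) <= exp (- 1). In the same way
  A(x) <= (x / (1 - x) - x^l) * exp (A(x)) * E(x), so for x slightly larger than rho the factor of
  exp (A(x)) is still below exp (- 1), and induction on the weight bounds the partial sums of A(x) by 1.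
  The counts of rooted trees, being essentially supermultiplicative, eventually exceed a constant
  times z^(-n) for each z > rho.
*)

theory Submission
  imports Defs "HOL-Analysis.Analysis" "HOL-Library.Multiset"
begin

text \<open>\<open>L\<close> is sought only downwards, as some of the children of a vertex with
  everything below them. A limb found in this way does not depend on the chosen root, so a class
  without \<open>L\<close> has only avoiding rootings, and one of them suffices to count it. The
  factor \<open>n\<close> enters only through the number of all classes. The exponent of E sums
  terms of order x^(2n) over the trees of weight n, so it converges once x^2 <= rho. This reaches
  beyond rho because 0 < rho < 1, which has to be proved. For x > rho the convergence of A is what
  is to be shown, so the functional equation cannot be used as an equation there. It is replaced by
  an inequality between partial sums: trees of weight at most N + 1 are roots over trees of weight
  at most N. The bound 1 survives this step because 1 is the fixed point of s -> exp (s - 1). The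
  term x^l may be subtracted only from N = l on, when the subtrees of \<open>L\<close> are among the
  trees counted; the start comes from a strict inequality at rho and continuity.\<close>

section \<open>Undirected trees\<close>

text \<open>Acyclicity is stated as every edge being a bridge. In this form it can be proved by
  mapping walks, without handling lists of arcs.\<close>

definition tree_on :: "'a set \<Rightarrow> 'a rel \<Rightarrow> bool" where
  "tree_on V E \<longleftrightarrow> finite V \<and> V \<noteq> {} \<and> E \<subseteq> V \<times> V \<and> sym E \<and> irrefl E \<and>
     (\<forall>x \<in> V. \<forall>y \<in> V. (x, y) \<in> E\<^sup>*) \<and>
     (\<forall>a b. (a, b) \<in> E \<longrightarrow> (a, b) \<notin> (E - {(a, b), (b, a)})\<^sup>*)"

lemma reachable_with_proj:
  assumes "E \<subseteq> V \<times> V"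
  shows "u \<rightarrow>\<^sup>*\<^bsub>with_proj \<lparr>pverts = V, parcs = E\<rparr>\<^esub> v \<longleftrightarrow> u \<in> V \<and> (u, v) \<in> E\<^sup>*"
proof -
  interpret pair_wf_digraph "\<lparr>pverts = V, parcs = E\<rparr>"
    using assms by unfold_locales auto
  show ?thesis
  proof
    assume "u \<rightarrow>\<^sup>*\<^bsub>with_proj \<lparr>pverts = V, parcs = E\<rparr>\<^esub> v"
    then show "u \<in> V \<and> (u, v) \<in> E\<^sup>*"
      using reachable_rtranclI[of "with_proj \<lparr>pverts = V, parcs = E\<rparr>" u v] reachable_in_verts(1)[of u v] by simp
  next
    assume "u \<in> V \<and> (u, v) \<in> E\<^sup>*"
    then have "(u, v) \<in> E\<^sup>*" "u \<in> V" by auto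
    then show "u \<rightarrow>\<^sup>*\<^bsub>with_proj \<lparr>pverts = V, parcs = E\<rparr>\<^esub> v"
    proof (induction rule: rtrancl_induct)
      case base then show ?case by (simp add: reachable_refl)
    next
      case (step y z)
      then show ?case using reachable_adj_trans[of u y z] by simp
    qed
  qed
qed

lemma distinct_walk_arc:
  assumes "pcas u p v" "distinct (pawalk_verts u p)" "(u, x) \<in> set p"
  shows "hd p = (u, x)"
proof (cases p)
  case (Cons e q)
  have *: "(u, x) \<in> set q \<Longrightarrow> u \<in> set (pawalk_verts w q)" for w
    by (induction q arbitrary: w) auto
  show ?thesis using assms Cons * by auto
qed (use assms in auto)

lemma pawalk_verts_last:
  assumes "pcas u p v"
  shows "v \<in> set (pawalk_verts u p)"
  using assms by (induction p arbitrary: u) auto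

lemma distinct_closed_walk:
  assumes "pcas u p u" "distinct (pawalk_verts u p)"
  shows "p = []"
proof (cases p)
  case (Cons e q)
  then show ?thesis using assms pawalk_verts_last[of "snd e" q u] by auto
qed simp

lemma pawalk_verts_append:
  "pcas u p v \<Longrightarrow> pcas v q w \<Longrightarrow> pawalk_verts u (p @ q) = pawalk_verts u p @ tl (pawalk_verts v q)"
  by (induction p arbitrary: u) (cases q, auto)

lemma pcas_append: "pcas u p v \<Longrightarrow> pcas v q w \<Longrightarrow> pcas u (p @ q) w"
  by (induction p arbitrary: u) auto

text \<open>Deleting one edge from a cycle of length at least 3 leaves a detour between its ends;
  conversely, a path that bypasses an edge is closed by that edge to such a cycle.\<close>

lemma undirected_tree_iff:
  "undirected_tree (with_proj G) \<longleftrightarrow> tree_on (pverts G) (parcs G)"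
proof -
  obtain V E where G: "G = \<lparr>pverts = V, parcs = E\<rparr>"
    by (cases G) auto
  have graph_iff: "graph (with_proj G) \<longleftrightarrow> finite V \<and> E \<subseteq> V \<times> V \<and> sym E \<and> irrefl E" (is "_ \<longleftrightarrow> ?R")
  proof
    assume "graph (with_proj G)"
    then interpret pair_graph G by (rule pair_graphI_graph)
    show ?R
      using pair_finite_verts arc_fst_in_verts arc_snd_in_verts pair_sym_arcs pair_no_loops
      by (force simp: G symmetric_def irrefl_def)
  next
    assume R: ?R
    then have "finite E" using finite_subset by blast
    then interpret pair_graph G
      using R by unfold_locales (auto simp: G symmetric_def irrefl_def)
    show "graph (with_proj G)" by (rule pair_graphD_graph)
  qed
  have connected_iff: "Digraph_Component.connected (with_proj G) \<longleftrightarrow>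
      V \<noteq> {} \<and> (\<forall>x \<in> V. \<forall>y \<in> V. (x, y) \<in> E\<^sup>*)" if "E \<subseteq> V \<times> V" "sym E"
  proof -
    have "mk_symmetric (with_proj G) = \<lparr>pverts = V, parcs = E\<rparr>"
      using \<open>sym E\<close> by (auto simp: mk_symmetric_def G sym_def)
    then show ?thesis
      using reachable_with_proj[OF \<open>E \<subseteq> V \<times> V\<close>]
      by (auto simp: Digraph_Component.connected_def strongly_connected_def)
  qed
  have cycle_iff: "(\<exists>p. pre_digraph.cycle (with_proj G) p \<and> 3 \<le> length p) \<longleftrightarrow>
      (\<exists>a b. (a, b) \<in> E \<and> (a, b) \<in> (E - {(a, b), (b, a)})\<^sup>*)" (is "?L \<longleftrightarrow> ?R")
    if R: "E \<subseteq> V \<times> V" "sym E" "irrefl E"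
  proof -
    interpret pair_wf_digraph G
      using R by unfold_locales (auto simp: G)
    show ?thesis
    proof
      assume ?L
      then obtain p u where p: "pcas u p u" "set p \<subseteq> E" "distinct (tl (pawalk_verts u p))" "3 \<le> length p"
      proof -
        from \<open>?L\<close> obtain p u where "awalk u p u" "distinct (tl (pawalk_verts u p))" "3 \<le> length p"
          unfolding cycle_def by auto
        then show thesis using that[of u p] unfolding awalk_def by (simp add: G)
      qed
      then obtain e q where e: "p = e # q" by (cases p) auto
      define b where "b = snd e"
      have eub: "e = (u, b)" and q: "pcas b q u" "distinct (pawalk_verts b q)" "2 \<le> length q"
        using p e by (auto simp: b_def)
      \<comment> \<open>Being a path from \<open>b\<close>, \<open>q\<close> could use this arc only
        as its first one. It would then already be at its end \<open>u\<close>, and the cycle would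
        have length 2.\<close>
      have "(b, u) \<notin> set q"
      proof
        assume *: "(b, u) \<in> set q"
        obtain q' where q': "q = (b, u) # q'"
          using distinct_walk_arc[OF q(1,2) *] * by (cases q) auto
        then have "q' = []" using q distinct_closed_walk[of u q'] by auto
        then show False using q q' by auto
      qed
      \<comment> \<open>The path \<open>q\<close> ends in \<open>u\<close>, so an arc of
        \<open>q\<close> leaving \<open>u\<close> would make \<open>u\<close> occur twice.\<close>
      moreover have "(u, b) \<notin> set q"
      proof
        assume "(u, b) \<in> set q"
        then obtain q1 q2 where q12: "q = q1 @ (u, b) # q2" by (meson split_list)
        have "awalk_verts b q = map fst q @ [snd (last q)]" "snd (last q) = u"
          using q12 q(1) awalk_verts_conv[of b q] awlast_if_cas[of b q u] by auto
        then show False using q(2) q12 by auto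
      qed
      ultimately have q_sub: "set q \<subseteq> E - {(b, u), (u, b)}"
        using p e by auto
      have "pcas w q u \<Longrightarrow> set q \<subseteq> F \<Longrightarrow> (w, u) \<in> F\<^sup>*" for w and F :: "'a rel"
        by (induction q arbitrary: w) (auto intro: converse_rtrancl_into_rtrancl)
      from this[OF q(1) q_sub] have "(b, u) \<in> (E - {(b, u), (u, b)})\<^sup>*" .
      moreover have "(b, u) \<in> E" using symD[OF R(2), of u b] p e eub by simp
      ultimately show ?R by blast
    next
      assume ?R
      then obtain a b where ab: "(a, b) \<in> E" "(a, b) \<in> (E - {(a, b), (b, a)})\<^sup>*" by blast
      let ?F = "E - {(a, b), (b, a)}"
      interpret F: pair_wf_digraph "\<lparr>pverts = V, parcs = ?F\<rparr>"
        using R by unfold_locales auto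
      have "a \<in> V" "a \<noteq> b" using ab R by (auto simp: irrefl_def)
      have sub: "?F \<subseteq> V \<times> V" using R by auto
      then obtain p where p: "F.apath a p b"
        using reachable_with_proj[OF sub, of a b] ab \<open>a \<in> V\<close> F.reachable_apath by blast
      then have p': "pcas a p b" "set p \<subseteq> ?F" "distinct (pawalk_verts a p)"
        by (auto simp: F.apath_def F.awalk_def)
      have len: "2 \<le> length p"
      proof (rule ccontr)
        assume "\<not> 2 \<le> length p"
        then consider "p = []" | e where "p = [e]"
          by (cases p; cases "tl p") auto
        then show False using p' \<open>a \<noteq> b\<close> by cases auto
      qed
      let ?c = "p @ [(b, a)]"
      have "awalk a ?c a"
      proof -
        have "pcas b [(b, a)] a" by simp
        then have "pcas a ?c a" by (rule pcas_append[OF p'(1)])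
        moreover have "(b, a) \<in> E" using symD[OF R(2) ab(1)] .
        moreover have "set ?c \<subseteq> E" using p'(2) \<open>(b, a) \<in> E\<close> by auto
        moreover have "parcs G = E" "pverts G = V" by (simp_all add: G)
        ultimately show ?thesis unfolding awalk_def using \<open>a \<in> V\<close> by blast
      qed
      moreover have "distinct (tl (pawalk_verts a ?c))"
      proof -
        obtain l where "pawalk_verts a p = a # l"
          using p'(1) by (cases p) auto
        moreover from this have "a \<notin> set l" "distinct l" using p'(3) by simp_all
        moreover have "tl (pawalk_verts b [(b, a)]) = [a]" by simp
        ultimately have "pawalk_verts a ?c = a # l @ [a]"
          using pawalk_verts_append[OF p'(1), of "[(b, a)]" a] by (metis append_Cons pcas.simps fst_conv snd_conv)
        then have "tl (pawalk_verts a ?c) = l @ [a]" by (metis list.sel(3))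
        moreover have "distinct (l @ [a])" using \<open>a \<notin> set l\<close> \<open>distinct l\<close> by simp
        ultimately show ?thesis by metis
      qed
      ultimately have "cycle ?c" unfolding cycle_def by blast
      moreover have "3 \<le> length ?c" using len by simp
      ultimately show ?L by blast
    qed
  qed
  show ?thesis
  proof (cases "finite V \<and> E \<subseteq> V \<times> V \<and> sym E \<and> irrefl E")
    case True
    then have R: "E \<subseteq> V \<times> V" "sym E" "irrefl E" "finite V" by auto
    show ?thesis
      unfolding undirected_tree_def tree_on_def graph_iff connected_iff[OF R(1,2)] cycle_iff[OF R(1-3)]
      by (simp add: G R)
  next
    case False
    then show ?thesis
      unfolding undirected_tree_def tree_on_def graph_iff by (auto simp: G)
  qed
qed

section \<open>Codes of rooted trees\<close>

text \<open>Children form a multiset, so that equality of these terms amounts to isomorphism of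
  weighted rooted trees.\<close>

datatype rtree = Node nat "rtree multiset"

primrec wt :: "rtree \<Rightarrow> nat" where
  "wt (Node k M) = Suc k + sum_mset (image_mset wt M)"

text \<open>\<open>Node k M\<close> has root weight \<open>k + 1\<close>, so that all weights are positive. \<open>codes w v V E t\<close> says that
  the tree \<open>(V, E)\<close> with root \<open>v\<close> and weights \<open>w\<close> has shape \<open>t\<close>; attaching the branches at the root one at
  a time, in any order, keeps every induction binary.\<close>

inductive codes :: "('a \<Rightarrow> nat) \<Rightarrow> 'a \<Rightarrow> 'a set \<Rightarrow> 'a rel \<Rightarrow> rtree \<Rightarrow> bool" for w where
  leaf: "w v = Suc k \<Longrightarrow> codes w v {v} {} (Node k {#})"
| attach: "codes w v V E (Node k M) \<Longrightarrow> codes w c U F s \<Longrightarrow> V \<inter> U = {} \<Longrightarrow>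
    codes w v (V \<union> U) (E \<union> F \<union> {(v, c), (c, v)}) (Node k (add_mset s M))"

lemma codes_finite: "codes w v V E t \<Longrightarrow> finite V"
  and codes_root: "codes w v V E t \<Longrightarrow> v \<in> V"
  and codes_arcs: "codes w v V E t \<Longrightarrow> E \<subseteq> V \<times> V"
  and codes_sym: "codes w v V E t \<Longrightarrow> sym E"
  and codes_positive: "codes w v V E t \<Longrightarrow> \<forall>x \<in> V. 0 < w x"
proof -
  show "codes w v V E t \<Longrightarrow> finite V" by (induction rule: codes.induct) auto
  show *: "codes w v V E t \<Longrightarrow> v \<in> V" for v V E t by (induction rule: codes.induct) auto
  show "codes w v V E t \<Longrightarrow> E \<subseteq> V \<times> V" by (induction rule: codes.induct) (auto dest: *)
  show "codes w v V E t \<Longrightarrow> sym E" by (induction rule: codes.induct) (auto simp: sym_def)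
  show "codes w v V E t \<Longrightarrow> \<forall>x \<in> V. 0 < w x" by (induction rule: codes.induct) auto
qed

lemma codes_wt: "codes w v V E t \<Longrightarrow> wt t = sum w V"
  by (induction rule: codes.induct) (auto simp: sum.union_disjoint codes_finite)

lemma codes_connected_from_root: "codes w v V E t \<Longrightarrow> x \<in> V \<Longrightarrow> (v, x) \<in> E\<^sup>*"
proof (induction arbitrary: x rule: codes.induct)
  case (attach v V E k M c U F s)
  let ?G = "E \<union> F \<union> {(v, c), (c, v)}"
  have mono: "E\<^sup>* \<subseteq> ?G\<^sup>*" "F\<^sup>* \<subseteq> ?G\<^sup>*" by (auto intro!: rtrancl_mono)
  show ?case
  proof (cases "x \<in> V")
    case True
    then show ?thesis using attach.IH(1) mono by blast
  next
    case False
    then have "(c, x) \<in> ?G\<^sup>*" using attach mono by blast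
    moreover have "(v, c) \<in> ?G" by simp
    ultimately show ?thesis by (rule converse_rtrancl_into_rtrancl[rotated])
  qed
qed simp

lemma codes_connected:
  assumes "codes w v V E t" "x \<in> V" "y \<in> V"
  shows "(x, y) \<in> E\<^sup>*"
proof -
  have "(x, v) \<in> E\<^sup>*"
    using codes_connected_from_root[OF assms(1,2)] codes_sym[OF assms(1)]
    by (metis symD sym_rtrancl)
  then show ?thesis using codes_connected_from_root[OF assms(1,3)] by simp
qed

text \<open>The closure \<open>S\<^sup>*\<close> in the hypothesis lets \<open>f\<close> contract
  arcs to points, as the collapsing maps of \<open>codes_bridge\<close> do.\<close>

lemma rtrancl_image:
  assumes "(x, y) \<in> R\<^sup>*" "\<And>a b. (a, b) \<in> R \<Longrightarrow> (f a, f b) \<in> S\<^sup>*"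
  shows "(f x, f y) \<in> S\<^sup>*"
  using assms(1)
proof (induction rule: rtrancl_induct)
  case (step y z)
  then show ?case using assms(2)[OF step.hyps(2)] by (meson rtrancl_trans)
qed simp

text \<open>Collapsing the other side of the bridge turns a detour around an edge of one side
  into a detour within that side.\<close>

lemma codes_bridge: "codes w v V E t \<Longrightarrow> (a, b) \<in> E \<Longrightarrow> (a, b) \<notin> (E - {(a, b), (b, a)})\<^sup>*"
proof (induction arbitrary: a b rule: codes.induct)
  case (attach v V E k M c U F s)
  note E = codes_arcs[OF attach.hyps(1)] and F = codes_arcs[OF attach.hyps(2)]
  note v = codes_root[OF attach.hyps(1)] and c = codes_root[OF attach.hyps(2)]
  let ?G = "E \<union> F \<union> {(v, c), (c, v)}"
  let ?R = "?G - {(a, b), (b, a)}"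
  note disj = \<open>V \<inter> U = {}\<close>
  consider "(a, b) \<in> E" | "(a, b) \<in> F" | "(a, b) = (v, c) \<or> (a, b) = (c, v)"
    using attach.prems by auto
  then show ?case
  proof cases
    case 1
    then have ab: "a \<in> V" "b \<in> V" using E by auto
    define f where "f x = (if x \<in> V then x else v)" for x
    show ?thesis
    proof
      assume "(a, b) \<in> ?R\<^sup>*"
      then have "(f a, f b) \<in> (E - {(a, b), (b, a)})\<^sup>*"
        by (rule rtrancl_image) (use E F v c disj ab in \<open>auto simp: f_def\<close>)
      then show False using attach.IH(1)[OF 1] ab by (simp add: f_def)
    qed
  next
    case 2
    then have ab: "a \<in> U" "b \<in> U" using F by auto
    define f where "f x = (if x \<in> U then x else c)" for x
    show ?thesis
    proof
      assume "(a, b) \<in> ?R\<^sup>*"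
      then have "(f a, f b) \<in> (F - {(a, b), (b, a)})\<^sup>*"
        by (rule rtrancl_image) (use E F v c disj ab in \<open>auto simp: f_def\<close>)
      then show False using attach.IH(2)[OF 2] ab by (simp add: f_def)
    qed
  next
    case 3
    then have R: "?R = (E \<union> F) - {(v, c), (c, v)}" by auto
    have *: "(x, y) \<in> ?R \<Longrightarrow> x \<in> V \<longleftrightarrow> y \<in> V" for x y
      unfolding R using E F disj by auto
    have "(x, y) \<in> ?R\<^sup>* \<Longrightarrow> x \<in> V \<longleftrightarrow> y \<in> V" for x y
      by (induction rule: rtrancl_induct) (use * in auto)
    then show ?thesis using 3 v c disj by blast
  qed
qed simp

lemma codes_irrefl: "codes w v V E t \<Longrightarrow> irrefl E"
  unfolding irrefl_def using codes_bridge by (metis rtrancl.rtrancl_refl)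

lemma codes_tree_on:
  assumes "codes w v V E t"
  shows "tree_on V E"
  unfolding tree_on_def
  using codes_finite[OF assms] codes_root[OF assms] codes_arcs[OF assms] codes_sym[OF assms]
    codes_irrefl[OF assms] codes_connected[OF assms] codes_bridge[OF assms] by blast

text \<open>The growth step for finding a code of a given tree: a new vertex turns up next to an
  arbitrary \<open>x\<close>, not only at the root, and the code is rebuilt along the way down to
  \<open>x\<close>.\<close>

lemma codes_attach_leaf:
  "codes w v V E t \<Longrightarrow> x \<in> V \<Longrightarrow> u \<notin> V \<Longrightarrow> 0 < w u \<Longrightarrow>
    \<exists>t'. codes w v (insert u V) (E \<union> {(x, u), (u, x)}) t'"
proof (induction rule: codes.induct)
  case (leaf v k)
  have "codes w u {u} {} (Node (w u - 1) {#})" using leaf by (intro codes.leaf) simp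
  then have "codes w v ({v} \<union> {u}) ({} \<union> {} \<union> {(v, u), (u, v)}) (Node k (add_mset (Node (w u - 1) {#}) {#}))"
    using leaf by (intro codes.attach codes.leaf) auto
  then show ?case using leaf by (auto simp: insert_commute)
next
  case (attach v V E k M c U F s)
  show ?case
  proof (cases "x \<in> V")
    case True
    then obtain t' where t': "codes w v (insert u V) (E \<union> {(x, u), (u, x)}) t'"
      using attach by auto
    obtain k' M' where "t' = Node k' M'" by (cases t')
    moreover have "insert u V \<inter> U = {}" using attach by auto
    ultimately have "codes w v (insert u V \<union> U) (E \<union> {(x, u), (u, x)} \<union> F \<union> {(v, c), (c, v)})
        (Node k' (add_mset s M'))"
      using t' attach.hyps by (intro codes.attach) simp_all
    moreover have "insert u V \<union> U = insert u (V \<union> U)"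
      "E \<union> {(x, u), (u, x)} \<union> F \<union> {(v, c), (c, v)} = E \<union> F \<union> {(v, c), (c, v)} \<union> {(x, u), (u, x)}"
      by auto
    ultimately show ?thesis by metis
  next
    case False
    then obtain t' where t': "codes w c (insert u U) (F \<union> {(x, u), (u, x)}) t'"
      using attach by auto
    moreover have "V \<inter> insert u U = {}" using attach by auto
    ultimately have "codes w v (V \<union> insert u U) (E \<union> (F \<union> {(x, u), (u, x)}) \<union> {(v, c), (c, v)})
        (Node k (add_mset t' M))"
      using attach.hyps by (intro codes.attach) simp_all
    moreover have "V \<union> insert u U = insert u (V \<union> U)"
      "E \<union> (F \<union> {(x, u), (u, x)}) \<union> {(v, c), (c, v)} = E \<union> F \<union> {(v, c), (c, v)} \<union> {(x, u), (u, x)}"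
      by auto
    ultimately show ?thesis by metis
  qed
qed

text \<open>A coded subtree of maximal size is spanning, and then an arc outside of it would close a cycle.\<close>

lemma tree_on_codes:
  assumes tree: "tree_on V E" and v: "v \<in> V" and pos: "\<forall>x \<in> V. 0 < w x"
  shows "\<exists>t. codes w v V E t"
proof -
  have fin: "finite V" and sym: "sym E" and E: "E \<subseteq> V \<times> V"
    using tree by (auto simp: tree_on_def)
  define P where "P U \<longleftrightarrow> U \<subseteq> V \<and> (\<exists>F t. F \<subseteq> E \<and> codes w v U F t)" for U
  have "P {v}"
    using v pos codes.leaf[of w v "w v - 1"] by (auto simp: P_def)
  moreover have "\<forall>U. P U \<longrightarrow> card U < Suc (card V)"
    using fin by (simp add: P_def card_mono less_Suc_eq_le)
  ultimately obtain U where U: "P U" "\<And>U'. P U' \<Longrightarrow> card U' \<le> card U"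
    using Lattices_Big.ex_has_greatest_nat[of P "{v}" card "Suc (card V)"] by blast
  then obtain F t where F: "F \<subseteq> E" "U \<subseteq> V" and t: "codes w v U F t"
    by (auto simp: P_def)
  have "V \<subseteq> U"
  proof
    fix y assume "y \<in> V"
    then have "(v, y) \<in> E\<^sup>*" using tree v by (auto simp: tree_on_def)
    then show "y \<in> U"
    proof (induction rule: rtrancl_induct)
      case base
      then show ?case using codes_root[OF t] .
    next
      case (step x u)
      show ?case
      proof (rule ccontr)
        assume "u \<notin> U"
        moreover have "u \<in> V" using step E by auto
        ultimately obtain t' where "codes w v (insert u U) (F \<union> {(x, u), (u, x)}) t'"
          using codes_attach_leaf[OF t step.IH] pos by blast
        moreover have "(u, x) \<in> E" using symD[OF sym] step by blast
        ultimately have "F \<union> {(x, u), (u, x)} \<subseteq> E" "insert u U \<subseteq> V"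
          "codes w v (insert u U) (F \<union> {(x, u), (u, x)}) t'"
          using \<open>u \<in> V\<close> F step(2) by auto
        then have "P (insert u U)"
          unfolding P_def by metis
        then have "card (insert u U) \<le> card U" by (rule U)
        then show False using \<open>u \<notin> U\<close> codes_finite[OF t] by simp
      qed
    qed
  qed
  then have "U = V" using F by blast
  have "E \<subseteq> F"
  proof clarify
    fix a b assume ab: "(a, b) \<in> E"
    show "(a, b) \<in> F"
    proof (rule ccontr)
      assume "(a, b) \<notin> F"
      then have "F \<subseteq> E - {(a, b), (b, a)}"
        using F symD[OF codes_sym[OF t], of b a] by blast
      moreover have "(a, b) \<in> F\<^sup>*"
        using codes_connected[OF t] ab E \<open>U = V\<close> by blast
      ultimately have "(a, b) \<in> (E - {(a, b), (b, a)})\<^sup>*"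
        using rtrancl_mono by blast
      then show False using tree ab by (auto simp: tree_on_def)
    qed
  qed
  then show ?thesis using t F \<open>U = V\<close> by auto
qed

text \<open>The order of attachment is immaterial: if \<open>s\<close> was not attached last, it is
  detached from the earlier tree and the last branch is attached again.\<close>

lemma codes_detach:
  "codes w v V E t \<Longrightarrow> t = Node k (add_mset s M) \<Longrightarrow>
    \<exists>V1 E1 c U F. codes w v V1 E1 (Node k M) \<and> codes w c U F s \<and> V1 \<inter> U = {} \<and>
      V = V1 \<union> U \<and> E = E1 \<union> F \<union> {(v, c), (c, v)}"
proof (induction arbitrary: s M rule: codes.induct)
  case (attach v V E k' M0 c U F s0)
  then have k: "k' = k" and eq: "add_mset s0 M0 = add_mset s M" by auto
  from eq consider "s0 = s" "M0 = M" | K where "M0 = add_mset s K" "M = add_mset s0 K"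
    by (auto simp: add_eq_conv_ex)
  then show ?case
  proof cases
    case 1
    show ?thesis
      by (rule exI[of _ V], rule exI[of _ E], rule exI[of _ c], rule exI[of _ U], rule exI[of _ F])
        (use attach.hyps 1 k in simp)
  next
    case 2
    then have "Node k' M0 = Node k (add_mset s K)" using k by simp
    from attach.IH(1)[OF this] obtain V1 E1 c1 U1 F1 where
      1: "codes w v V1 E1 (Node k K)" "codes w c1 U1 F1 s" "V1 \<inter> U1 = {}"
        "V = V1 \<union> U1" "E = E1 \<union> F1 \<union> {(v, c1), (c1, v)}" by blast
    have "V1 \<inter> U = {}" using attach.hyps(3) 1 by auto
    note 2 = codes.attach[OF 1(1) attach.hyps(2) this, folded \<open>M = add_mset s0 K\<close>]
    show ?thesis
      by (rule exI[of _ "V1 \<union> U"], rule exI[of _ "E1 \<union> F \<union> {(v, c), (c, v)}"],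
          rule exI[of _ c1], rule exI[of _ U1], rule exI[of _ F1])
        (use attach.hyps(3) 1 2 in auto)
  qed
qed simp

lemma codes_detach_child:
  "codes w v V E t \<Longrightarrow> (v, c) \<in> E \<Longrightarrow>
    \<exists>V1 E1 U F k M s. t = Node k (add_mset s M) \<and> codes w v V1 E1 (Node k M) \<and> codes w c U F s \<and>
      V1 \<inter> U = {} \<and> V = V1 \<union> U \<and> E = E1 \<union> F \<union> {(v, c), (c, v)}"
proof (induction rule: codes.induct)
  case (attach v V E k M c0 U F s0)
  note v = codes_root[OF attach.hyps(1)] and c0 = codes_root[OF attach.hyps(2)]
  have "(v, c) \<notin> F" using codes_arcs[OF attach.hyps(2)] v attach.hyps(3) by auto
  then consider "c = c0" | "(v, c) \<in> E" using attach.prems v c0 attach.hyps(3) by auto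
  then show ?case
  proof cases
    case 1
    show ?thesis
      by (rule exI[of _ V], rule exI[of _ E], rule exI[of _ U], rule exI[of _ F],
          rule exI[of _ k], rule exI[of _ M], rule exI[of _ s0])
        (use attach.hyps 1 in simp)
  next
    case 2
    from attach.IH(1)[OF this] obtain V1 E1 U1 F1 M1 s where
      1: "M = add_mset s M1" "codes w v V1 E1 (Node k M1)" "codes w c U1 F1 s" "V1 \<inter> U1 = {}"
        "V = V1 \<union> U1" "E = E1 \<union> F1 \<union> {(v, c), (c, v)}" by blast
    have "V1 \<inter> U = {}" using attach.hyps(3) 1 by auto
    note 2 = codes.attach[OF 1(2) attach.hyps(2) this]
    show ?thesis
      by (rule exI[of _ "V1 \<union> U"], rule exI[of _ "E1 \<union> F \<union> {(v, c0), (c0, v)}"],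
          rule exI[of _ U1], rule exI[of _ F1],
          rule exI[of _ k], rule exI[of _ "add_mset s0 M1"], rule exI[of _ s])
        (use attach.hyps(3) 1 2 in auto)
  qed
qed simp

text \<open>Walks from \<open>c\<close> inside \<open>F1\<close> never visit \<open>v\<close>, and
  in the second splitting the only way out of \<open>U2\<close> leads to \<open>v\<close>.\<close>

lemma codes_bridge_side_subset:
  assumes "codes w v V1 E1 t1" "codes w c U1 F1 s1" "V1 \<inter> U1 = {}"
    and "codes w v V2 E2 t2" "codes w c U2 F2 s2" "V2 \<inter> U2 = {}"
    and "E1 \<union> F1 \<union> {(v, c), (c, v)} = E2 \<union> F2 \<union> {(v, c), (c, v)}"
  shows "U1 \<subseteq> U2"
proof
  fix x assume "x \<in> U1"
  then have "(c, x) \<in> F1\<^sup>*" by (rule codes_connected_from_root[OF assms(2)])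
  then show "x \<in> U2"
  proof (induction rule: rtrancl_induct)
    case base
    then show ?case using codes_root[OF assms(5)] .
  next
    case (step y z)
    have "(y, z) \<in> E2 \<union> F2 \<union> {(v, c), (c, v)}" using step.hyps assms(7) by blast
    moreover have "(y, z) \<notin> E2" using codes_arcs[OF assms(4)] step.IH assms(6) by auto
    moreover have "z \<noteq> v"
      using codes_arcs[OF assms(2)] codes_root[OF assms(1)] step.hyps(2) assms(3) by auto
    ultimately show ?case using codes_arcs[OF assms(5)] codes_root[OF assms(5)] by auto
  qed
qed

text \<open>Inclusion in both directions fixes the two sides, and each side carries exactly the arcs
  with both ends in it.\<close>

lemma codes_split_unique:
  assumes 1: "codes w v V1 E1 t1" "codes w c U1 F1 s1" "V1 \<inter> U1 = {}"
    and 2: "codes w v V2 E2 t2" "codes w c U2 F2 s2" "V2 \<inter> U2 = {}"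
    and V: "V1 \<union> U1 = V2 \<union> U2"
    and E: "E1 \<union> F1 \<union> {(v, c), (c, v)} = E2 \<union> F2 \<union> {(v, c), (c, v)}"
  shows "V1 = V2 \<and> E1 = E2 \<and> U1 = U2 \<and> F1 = F2"
proof -
  have U: "U1 = U2"
    using codes_bridge_side_subset[OF 1 2 E] codes_bridge_side_subset[OF 2 1 E[symmetric]] by blast
  then have V': "V1 = V2" using V 1(3) 2(3) by blast
  have *: "E1 = (E1 \<union> F1 \<union> {(v, c), (c, v)}) \<inter> V1 \<times> V1 \<and>
           F1 = (E1 \<union> F1 \<union> {(v, c), (c, v)}) \<inter> U1 \<times> U1"
    if "codes w v V1 E1 t1" "codes w c U1 F1 s1" "V1 \<inter> U1 = {}" for V1 E1 U1 F1 t1 s1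
    using that(3) codes_arcs[OF that(1)] codes_arcs[OF that(2)] codes_root[OF that(1)] codes_root[OF that(2)]
    by auto
  show ?thesis using *[OF 1] *[OF 2] U V' E by simp
qed

text \<open>The child attached last in one derivation is detached, by its edge, from the other; both
  then split the tree in the same way.\<close>

lemma codes_unique: "codes w v V E t \<Longrightarrow> codes w v V E t' \<Longrightarrow> t = t'"
proof (induction arbitrary: t' rule: codes.induct)
  case (leaf v k)
  from leaf(2) show ?case by cases (use leaf(1) in auto)
next
  case (attach v V E k M c U F s)
  have "(v, c) \<in> E \<union> F \<union> {(v, c), (c, v)}" by simp
  from codes_detach_child[OF attach.prems this] obtain V1 E1 U1 F1 k1 M1 s1 where
    1: "t' = Node k1 (add_mset s1 M1)" "codes w v V1 E1 (Node k1 M1)" "codes w c U1 F1 s1"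
      "V1 \<inter> U1 = {}" "V \<union> U = V1 \<union> U1"
      "E \<union> F \<union> {(v, c), (c, v)} = E1 \<union> F1 \<union> {(v, c), (c, v)}" by blast
  have "V = V1 \<and> E = E1 \<and> U = U1 \<and> F = F1"
    by (rule codes_split_unique[OF attach.hyps(1-3) 1(2-6)])
  then have "Node k M = Node k1 M1" "s = s1" using attach.IH 1(2,3) by blast+
  then show ?case using 1(1) by simp
qed

definition tree_map ::
  "('a \<Rightarrow> 'b) \<Rightarrow> ('a \<Rightarrow> nat) \<Rightarrow> 'a set \<Rightarrow> 'a rel \<Rightarrow> ('b \<Rightarrow> nat) \<Rightarrow> 'b set \<Rightarrow> 'b rel \<Rightarrow> bool" where
  "tree_map h w V E w' V' E' \<longleftrightarrow>
     inj_on h V \<and> h ` V = V' \<and> map_prod h h ` E = E' \<and> (\<forall>x \<in> V. w' (h x) = w x)"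

lemma codes_transport:
  "codes w v V E t \<Longrightarrow> inj_on h V \<Longrightarrow> \<forall>x \<in> V. w' (h x) = w x \<Longrightarrow>
    codes w' (h v) (h ` V) (map_prod h h ` E) t"
proof (induction rule: codes.induct)
  case (leaf v k)
  then show ?case using codes.leaf[of w' "h v" k] by simp
next
  case (attach v V E k M c U F s)
  have "h ` V \<inter> h ` U = {}"
    using attach.prems(1) attach.hyps(3) by (simp add: inj_on_image_Int[symmetric, of h "V \<union> U"])
  moreover have "codes w' (h v) (h ` V) (map_prod h h ` E) (Node k M)"
    "codes w' (h c) (h ` U) (map_prod h h ` F) s"
    using attach.IH attach.prems by (simp_all add: inj_on_Un)
  ultimately show ?case
    using codes.attach[of w' "h v" "h ` V" "map_prod h h ` E" k M "h c"] by (simp add: image_Un)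
qed

text \<open>A branch of the second tree with the code of the branch attached last in the first is
  cut off, and the isomorphisms of the two disjoint parts are glued. With
  \<open>codes_transport\<close> and \<open>codes_unique\<close>, codes are a complete invariant of
  rooted trees.\<close>

lemma codes_same_iso:
  "codes w v V E t \<Longrightarrow> codes w' v' V' E' t \<Longrightarrow> \<exists>h. tree_map h w V E w' V' E' \<and> h v = v'"
proof (induction arbitrary: v' V' E' rule: codes.induct)
  case (leaf v k)
  from leaf(2) have "V' = {v'}" "E' = {}" "w' v' = Suc k"
    by (cases; simp)+
  then show ?case using leaf(1) by (intro exI[of _ "\<lambda>_. v'"]) (simp add: tree_map_def)
next
  case (attach v V E k M c U F s)
  from codes_detach[OF attach.prems refl] obtain V1 E1 c1 U1 F1 where
    1: "codes w' v' V1 E1 (Node k M)" "codes w' c1 U1 F1 s" "V1 \<inter> U1 = {}"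
      "V' = V1 \<union> U1" "E' = E1 \<union> F1 \<union> {(v', c1), (c1, v')}" by blast
  obtain f where f: "tree_map f w V E w' V1 E1" "f v = v'"
    using attach.IH(1)[OF 1(1)] by blast
  obtain g where g: "tree_map g w U F w' U1 F1" "g c = c1"
    using attach.IH(2)[OF 1(2)] by blast
  define h where "h x = (if x \<in> V then f x else g x)" for x
  have hV: "x \<in> V \<Longrightarrow> h x = f x" and hU: "x \<in> U \<Longrightarrow> h x = g x" for x
    using attach.hyps(3) by (auto simp: h_def)
  have img: "h ` V = V1" "h ` U = U1"
    using f g hV hU by (simp_all add: tree_map_def cong: image_cong)
  have inj: "inj_on h V" "inj_on h U"
    using f g inj_on_cong[of V h f] inj_on_cong[of U h g] hV hU by (simp_all add: tree_map_def)
  have "h ` (V - U) \<inter> h ` (U - V) = {}" using img 1(3) by blast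
  then have "inj_on h (V \<union> U)" using inj by (simp add: inj_on_Un)
  moreover have "h ` (V \<union> U) = V'" using img 1(4) by (simp add: image_Un)
  moreover have "map_prod h h ` E = map_prod f f ` E"
    by (rule image_cong) (use codes_arcs[OF attach.hyps(1)] hV in auto)
  moreover have "map_prod h h ` F = map_prod g g ` F"
    by (rule image_cong) (use codes_arcs[OF attach.hyps(2)] hU in auto)
  moreover have "h v = v'" "h c = c1"
    using codes_root[OF attach.hyps(1)] codes_root[OF attach.hyps(2)] hV hU f g by auto
  moreover have "\<forall>x \<in> V \<union> U. w' (h x) = w x"
    using f g hV hU by (auto simp: tree_map_def)
  ultimately have "tree_map h w (V \<union> U) (E \<union> F \<union> {(v, c), (c, v)}) w' V' E' \<and> h v = v'"
    using f(1) g(1) 1(5) by (simp add: tree_map_def image_Un)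
  then show ?case by blast
qed

text \<open>Avoiding a finite set \<open>X\<close> strengthens the induction, so that the branches
  of a node can be realized disjointly. As \<open>w\<close> is given in advance, each weight must be
  in infinite supply.\<close>

lemma codes_exists:
  assumes inf: "\<And>k. infinite {x. w x = Suc k}"
  shows "finite X \<Longrightarrow> \<exists>v V E. codes w v V E t \<and> V \<inter> X = {}"
proof (induction t arbitrary: X)
  case (Node k M)
  then show ?case
  proof (induction M arbitrary: X)
    case empty
    then have "infinite ({x. w x = Suc k} - X)"
      using inf[of k] by (simp add: Diff_infinite_finite)
    then obtain v where "w v = Suc k" "v \<notin> X"
      by (metis (mono_tags, lifting) DiffE infinite_imp_nonempty ex_in_conv mem_Collect_eq)
    then have "codes w v {v} {} (Node k {#}) \<and> {v} \<inter> X = {}" by (auto intro: codes.leaf)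
    then show ?case by blast
  next
    case (add s M)
    obtain v V E where 1: "codes w v V E (Node k M)" "V \<inter> X = {}"
      using add.IH[OF add.prems(1) add.prems(2)] by (metis union_single_eq_member add_mset_remove_trivial insertI2 set_mset_add_mset_insert)
    have "finite (V \<union> X)" using add.prems(2) codes_finite[OF 1(1)] by simp
    moreover have "s \<in># add_mset s M" by simp
    ultimately obtain c U F where 2: "codes w c U F s" "U \<inter> (V \<union> X) = {}"
      using add.prems(1) by metis
    have "V \<inter> U = {}" using 2 by auto
    note codes.attach[OF 1(1) 2(1) this]
    moreover have "(V \<union> U) \<inter> X = {}" using 1(2) 2(2) by auto
    ultimately show ?case by metis
  qed
qed

section \<open>Limbs\<close>

text \<open>The piece hanging off \<open>v\<close> in the larger graph: arcs leave it only through \<open>v\<close>.\<close>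

definition hangs_at :: "'a \<Rightarrow> 'a set \<Rightarrow> 'a rel \<Rightarrow> 'a set \<Rightarrow> 'a rel \<Rightarrow> bool" where
  "hangs_at v V E V0 E0 \<longleftrightarrow>
     V \<subseteq> V0 \<and> E \<subseteq> E0 \<and> (\<forall>a b. (a, b) \<in> E0 \<longrightarrow> a \<in> V \<longrightarrow> a \<noteq> v \<longrightarrow> (a, b) \<in> E)"

lemma hangs_atD:
  "hangs_at v V E V0 E0 \<Longrightarrow> (a, b) \<in> E0 \<Longrightarrow> a \<in> V \<Longrightarrow> a \<noteq> v \<Longrightarrow> (a, b) \<in> E"
  unfolding hangs_at_def by blast

text \<open>Each part loses only the connecting edge, and the end of that edge in the part is its
  root, which is exempt.\<close>

lemma hangs_at_detach:
  assumes 1: "codes w v V E t" "codes w c U F s" "V \<inter> U = {}"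
    and h: "hangs_at v (V \<union> U) (E \<union> F \<union> {(v, c), (c, v)}) V0 E0"
  shows "hangs_at v V E V0 E0" and "hangs_at c U F V0 E0"
proof -
  note v = codes_root[OF 1(1)] and c = codes_root[OF 1(2)]
    and E = codes_arcs[OF 1(1)] and F = codes_arcs[OF 1(2)]
  have out: "(a, b) \<in> E \<union> F \<union> {(v, c), (c, v)}" if "(a, b) \<in> E0" "a \<in> V \<union> U" "a \<noteq> v" for a b
    using hangs_atD[OF h] that by blast
  have sub: "V \<subseteq> V0" "U \<subseteq> V0" "E \<subseteq> E0" "F \<subseteq> E0" using h by (simp_all add: hangs_at_def)
  have "(a, b) \<in> E" if "(a, b) \<in> E0" "a \<in> V" "a \<noteq> v" for a b
    using out[of a b] that F c 1(3) by auto
  then show "hangs_at v V E V0 E0" using sub by (simp add: hangs_at_def)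
  have "(a, b) \<in> F" if "(a, b) \<in> E0" "a \<in> U" "a \<noteq> c" for a b
    using out[of a b] that E v 1(3) by auto
  then show "hangs_at c U F V0 E0" using sub by (simp add: hangs_at_def)
qed

text \<open>Maximality holds because a larger tree of degree 1 at \<open>v\<close> can leave
  \<open>v\<close> only towards \<open>c\<close>, while arcs out of \<open>U\<close> stay in
  \<open>U\<close> or return to \<open>v\<close>. By connectedness it gains no vertex.\<close>

lemma child_branch:
  fixes T :: "'a weighted_graph"
  assumes T: "tree_on (vertices T) (parcs (skeleton T))"
    and 1: "codes w v V E t" "codes w c U F s" "V \<inter> U = {}"
    and h: "hangs_at v (V \<union> U) (E \<union> F \<union> {(v, c), (c, v)}) (vertices T) (parcs (skeleton T))"
  shows "\<lparr>pverts = insert v U, parcs = F \<union> {(v, c), (c, v)}\<rparr> \<in> branches T v"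
proof -
  let ?B = "\<lparr>pverts = insert v U, parcs = F \<union> {(v, c), (c, v)}\<rparr>"
  let ?T = "with_proj (skeleton T)"
  note v = codes_root[OF 1(1)] and c = codes_root[OF 1(2)]
    and E = codes_arcs[OF 1(1)] and F = codes_arcs[OF 1(2)]
  have vU: "v \<notin> U" using v 1(3) by auto
  have "0 < w v" using codes_positive[OF 1(1)] v by auto
  \<comment> \<open>Attached to \<open>v\<close> alone, the child yields a code of the branch, which
    is therefore a tree.\<close>
  then have "codes w v {v} {} (Node (w v - 1) {#})" by (intro codes.leaf) simp
  then have "codes w v ({v} \<union> U) ({} \<union> F \<union> {(v, c), (c, v)}) (Node (w v - 1) (add_mset s {#}))"
    using 1(2) vU by (intro codes.attach) auto
  then have tB: "tree_on (insert v U) (F \<union> {(v, c), (c, v)})"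
    using codes_tree_on by fastforce
  have wfT: "wf_digraph ?T"
    unfolding wf_digraph_wp_iff using T by unfold_locales (auto simp: tree_on_def)
  have wfB: "wf_digraph (with_proj ?B)"
    unfolding wf_digraph_wp_iff using F c by unfold_locales auto
  have sub: "subgraph (with_proj ?B) ?T"
    unfolding subgraph_def using wfT wfB h v by (auto simp: hangs_at_def compatible_def)
  have "out_arcs (with_proj ?B) v = {(v, c)}"
    using F vU c by (auto simp: out_arcs_def)
  then have deg: "out_degree (with_proj ?B) v = 1" by (simp add: out_degree_def)
  have max: "H = with_proj ?B"
    if H: "subgraph (with_proj ?B) H" "subgraph H ?T" "undirected_tree H" "out_degree H v = 1" for H
  proof -
    define V' E' where "V' = verts H" and "E' = arcs H"
    have H_eq: "H = with_proj \<lparr>pverts = V', parcs = E'\<rparr>"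
      using H(2) by (cases H) (simp add: with_proj_def subgraph_def compatible_def V'_def E'_def)
    have tH: "tree_on V' E'"
      using H(3) unfolding H_eq undirected_tree_iff by simp
    have sub1: "insert v U \<subseteq> V'" "F \<union> {(v, c), (c, v)} \<subseteq> E'"
      using H(1) by (simp_all add: subgraph_def V'_def E'_def)
    have sub2: "E' \<subseteq> parcs (skeleton T)"
      using H(2) by (simp add: subgraph_def E'_def)
    have out: "out_arcs H v = {e \<in> E'. fst e = v}"
      unfolding H_eq by (auto simp: out_arcs_def)
    obtain e where "out_arcs H v = {e}"
      using H(4) by (auto simp: out_degree_def card_1_singleton_iff)
    then have e: "{e \<in> E'. fst e = v} = {e}" using out by simp
    have "(v, x) = e" if "(v, x) \<in> E'" for x
      using that by (subst singleton_iff[symmetric], subst e[symmetric]) simp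
    from this this[of c] have vx: "(v, x) \<in> E' \<Longrightarrow> x = c" for x
      using sub1(2) by (metis Un_iff insertCI prod.inject subsetD)
    have Ux: "(y, x) \<in> F \<union> {(c, v)}" if "(y, x) \<in> E'" "y \<in> U" for x y
    proof -
      have "(y, x) \<in> E \<union> F \<union> {(v, c), (c, v)}"
        using hangs_atD[OF h, of y x] that sub2 vU by blast
      then show ?thesis using E that 1(3) vU by auto
    qed
    have "x \<in> insert v U" if "x \<in> V'" for x
    proof -
      have "(v, x) \<in> E'\<^sup>*" using tH that sub1(1) unfolding tree_on_def by blast
      then show ?thesis
      proof (induction rule: rtrancl_induct)
        case (step y z)
        then show ?case using vx[of z] Ux[of y z] F c by auto
      qed simp
    qed
    then have V'_eq: "V' = insert v U" using sub1(1) by blast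
    have "E' \<subseteq> V' \<times> V'" using tH by (simp add: tree_on_def)
    then have "E' \<subseteq> F \<union> {(v, c), (c, v)}"
      using vx Ux V'_eq by auto
    then have "E' = F \<union> {(v, c), (c, v)}" using sub1(2) by blast
    then show ?thesis using V'_eq H_eq by simp
  qed
  have "undirected_tree (with_proj ?B)" using tB by (simp add: undirected_tree_iff)
  then show ?thesis
    unfolding branches_def pre_digraph.max_subgraph_def mem_Collect_eq
    using sub deg max by auto
qed

lemma hanging_limb:
  fixes T :: "'a weighted_graph"
  assumes T: "tree_on (vertices T) (parcs (skeleton T))"
  shows "codes w v V E t \<Longrightarrow> hangs_at v V E (vertices T) (parcs (skeleton T)) \<Longrightarrow>
    \<exists>\<B> \<subseteq> branches T v. limb T v \<B> = \<lparr>skeleton = \<lparr>pverts = V, parcs = E\<rparr>, weight = weight T\<rparr>"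
proof (induction rule: codes.induct)
  case (leaf v k)
  then show ?case by (intro exI[of _ "{}"]) (simp add: limb_def)
next
  case (attach v V E k M c U F s)
  let ?B = "\<lparr>pverts = insert v U, parcs = F \<union> {(v, c), (c, v)}\<rparr>"
  obtain \<B> where B: "\<B> \<subseteq> branches T v"
      "limb T v \<B> = \<lparr>skeleton = \<lparr>pverts = V, parcs = E\<rparr>, weight = weight T\<rparr>"
    using attach.IH(1) hangs_at_detach(1)[OF attach.hyps attach.prems] by blast
  have "?B \<in> branches T v" by (rule child_branch[OF T attach.hyps attach.prems])
  then have "insert ?B \<B> \<subseteq> branches T v" using B(1) by simp
  moreover have "limb T v (insert ?B \<B>) =
      \<lparr>skeleton = \<lparr>pverts = V \<union> U, parcs = E \<union> F \<union> {(v, c), (c, v)}\<rparr>, weight = weight T\<rparr>"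
    using B(2) codes_root[OF attach.hyps(1)] by (auto simp: limb_def)
  ultimately show ?case by blast
qed

text \<open>Children of the root may be dropped, since \<open>hangs_at\<close> does not restrict the
  arcs out of \<open>v\<close>.\<close>

lemma hanging_sub_limb:
  "codes w v V E (Node k (M + N)) \<Longrightarrow> hangs_at v V E V0 E0 \<Longrightarrow>
    \<exists>V1 E1. codes w v V1 E1 (Node k M) \<and> hangs_at v V1 E1 V0 E0"
proof (induction N arbitrary: V E)
  case (add s N)
  then have "codes w v V E (Node k (add_mset s (M + N)))" by simp
  from codes_detach[OF this refl] obtain V1 E1 c U F where
    1: "codes w v V1 E1 (Node k (M + N))" "codes w c U F s" "V1 \<inter> U = {}"
      "V = V1 \<union> U" "E = E1 \<union> F \<union> {(v, c), (c, v)}" by blast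
  show ?case
    using add.IH[OF 1(1)] hangs_at_detach(1)[OF 1(1-3)] add.prems(2) 1(4,5) by blast
qed auto

section \<open>Codes of unrooted trees\<close>

lemma wt_pos: "0 < wt t"
  by (cases t) simp

lemma size_le_sum_wt: "size M \<le> sum_mset (image_mset wt M)"
proof (induction M)
  case (add s M)
  then show ?case by (cases s) simp
qed simp

lemma wt_child_less: "s \<in># M \<Longrightarrow> wt s < wt (Node k M)"
  by (auto dest!: multi_member_split)

lemma finite_wt_le: "finite {t. wt t \<le> n}"
proof (induction n)
  case 0
  have "{t. wt t \<le> 0} = {}" using wt_pos by (simp add: leD)
  then show ?case by (simp only: finite.emptyI)
next
  case (Suc n)
  let ?L = "{ts. set ts \<subseteq> {t. wt t \<le> n} \<and> length ts \<le> n}"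
  have "t \<in> (\<lambda>(k, ts). Node k (mset ts)) ` ({..n} \<times> ?L)" if "wt t \<le> Suc n" for t
  proof (cases t)
    case (Node k M)
    obtain ts where ts: "M = mset ts" by (metis ex_mset)
    have "set ts \<subseteq> {t. wt t \<le> n}"
      using wt_child_less[of _ M k] that unfolding Node ts by fastforce
    moreover have "length ts \<le> n" "k \<le> n"
      using size_le_sum_wt[of M] that Node ts by auto
    ultimately show ?thesis unfolding Node ts by (auto intro!: image_eqI[of _ _ "(k, ts)"])
  qed
  then have "{t. wt t \<le> Suc n} \<subseteq> (\<lambda>(k, ts). Node k (mset ts)) ` ({..n} \<times> ?L)" by blast
  moreover have "finite ?L" using Suc by (rule finite_lists_length_le)
  ultimately show ?case by (meson finite_SigmaI finite_atMost finite_imageI finite_subset)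
qed

lemma finite_wt_eq: "finite {t. wt t = n \<and> P t}"
  by (rule finite_subset[OF _ finite_wt_le[of n]]) auto

text \<open>A limb consists of whole branches, so surplus children \<open>N\<close> are allowed at
  the root of the pattern but nowhere below it.\<close>

inductive has_pattern :: "nat \<Rightarrow> rtree multiset \<Rightarrow> rtree \<Rightarrow> bool" for k0 M0 where
  here: "has_pattern k0 M0 (Node k0 (M0 + N))"
| below: "has_pattern k0 M0 s \<Longrightarrow> s \<in># M \<Longrightarrow> has_pattern k0 M0 (Node k M)"

lemma pattern_hanging:
  "has_pattern k0 M0 t \<Longrightarrow> codes w v V E t \<Longrightarrow> hangs_at v V E V0 E0 \<Longrightarrow>
    \<exists>u U F. codes w u U F (Node k0 M0) \<and> hangs_at u U F V0 E0"
proof (induction arbitrary: v V E rule: has_pattern.induct)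
  case (here N)
  then show ?case using hanging_sub_limb[OF here.prems] by blast
next
  case (below s M k)
  obtain M' where M: "M = add_mset s M'" using below.hyps(2) by (metis multi_member_split)
  from codes_detach[OF below.prems(1), of k s M'] obtain V1 E1 c U F where
    1: "codes w v V1 E1 (Node k M')" "codes w c U F s" "V1 \<inter> U = {}"
      "V = V1 \<union> U" "E = E1 \<union> F \<union> {(v, c), (c, v)}" using M by blast
  have "hangs_at c U F V0 E0"
    using hangs_at_detach(2)[OF 1(1-3)] below.prems(2) 1(4,5) by simp
  then show ?case using below.IH[OF 1(2)] by blast
qed

abbreviation tree_codes :: "'a weighted_graph \<Rightarrow> 'a \<Rightarrow> rtree \<Rightarrow> bool" where
  "tree_codes T v \<equiv> codes (weight T) v (vertices T) (parcs (skeleton T))"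

text \<open>The rooted trees that arise from \<open>T\<close> by choosing a root. Roots equivalent
  under an automorphism give the same code.\<close>

definition code_set :: "'a weighted_graph \<Rightarrow> rtree set" where
  "code_set T = {t. \<exists>v. tree_codes T v t}"

lemma weighted_treeD: "weighted_tree T \<Longrightarrow> tree_on (vertices T) (parcs (skeleton T))"
  by (simp add: weighted_tree_def undirected_tree_iff)

lemma ex_tree_code:
  assumes "weighted_tree T" "v \<in> vertices T"
  shows "\<exists>t. tree_codes T v t"
  by (rule tree_on_codes) (use assms in \<open>auto simp: weighted_tree_def undirected_tree_iff\<close>)

lemma tree_map_weighted_isomorphism:
  assumes "tree_map h (weight S) (vertices S) (parcs (skeleton S)) (weight T) (vertices T) (parcs (skeleton T))"
    and "parcs (skeleton S) \<subseteq> vertices S \<times> vertices S"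
  shows "\<exists>i. weighted_isomorphism i S T \<and> iso_verts i = h"
proof -
  let ?i = "\<lparr>iso_verts = h, iso_arcs = map_prod h h, iso_head = snd, iso_tail = fst\<rparr>"
  have h: "inj_on h (vertices S)" "h ` vertices S = vertices T"
    "map_prod h h ` parcs (skeleton S) = parcs (skeleton T)" "\<forall>x \<in> vertices S. weight T (h x) = weight S x"
    using assms(1) by (simp_all add: tree_map_def)
  have "inj_on (map_prod h h) (parcs (skeleton S))"
    using map_prod_inj_on[OF h(1) h(1)] assms(2) by (rule inj_on_subset)
  moreover have "wf_digraph (with_proj (skeleton S))"
    unfolding wf_digraph_wp_iff using assms(2) by unfold_locales auto
  ultimately have "pre_digraph.digraph_isomorphism (with_proj (skeleton S)) ?i"
    using h(1) by (auto simp: pre_digraph.digraph_isomorphism_def)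
  moreover have "with_proj (skeleton T) = app_iso ?i (with_proj (skeleton S))"
    using h by (simp add: app_iso_def with_proj_def)
  ultimately have "weighted_isomorphism ?i S T"
    using h(4) by (simp add: weighted_isomorphism_def)
  then show ?thesis by (intro exI[of _ ?i]) simp
qed

lemma weighted_isomorphism_tree_map:
  assumes "weighted_isomorphism i S T"
  shows "tree_map (iso_verts i) (weight S) (vertices S) (parcs (skeleton S))
           (weight T) (vertices T) (parcs (skeleton T))"
proof -
  let ?S = "with_proj (skeleton S)" and ?T = "with_proj (skeleton T)"
  have i: "pre_digraph.digraph_isomorphism ?S i" and T: "?T = app_iso i ?S"
    and w: "\<forall>v \<in> vertices S. weight T (iso_verts i v) = weight S v"
    using assms by (auto simp: weighted_isomorphism_def)
  have "verts ?T = iso_verts i ` verts ?S" "arcs ?T = iso_arcs i ` arcs ?S"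
    "tail ?T = iso_tail i" "head ?T = iso_head i"
    unfolding T by (simp_all add: verts_app_iso arcs_app_iso tail_app_iso head_app_iso)
  then have T': "vertices T = iso_verts i ` vertices S" "parcs (skeleton T) = iso_arcs i ` parcs (skeleton S)"
    "iso_tail i = fst" "iso_head i = snd" by simp_all
  have "iso_arcs i a = map_prod (iso_verts i) (iso_verts i) a" if "a \<in> parcs (skeleton S)" for a
    using i that T'(3,4) by (cases a) (auto simp: pre_digraph.digraph_isomorphism_def prod_eq_iff)
  then have "parcs (skeleton T) = map_prod (iso_verts i) (iso_verts i) ` parcs (skeleton S)"
    unfolding T'(2) by (intro image_cong) auto
  then show ?thesis
    using i w T'(1) by (simp add: tree_map_def pre_digraph.digraph_isomorphism_def)
qed

lemma code_set_nonempty: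
  assumes "weighted_tree T"
  shows "code_set T \<noteq> {}"
proof -
  obtain v where "v \<in> vertices T" using weighted_treeD[OF assms] by (auto simp: tree_on_def)
  then show ?thesis using ex_tree_code[OF assms, of v] unfolding code_set_def by blast
qed

text \<open>One common code already yields an isomorphism, and an isomorphism carries every rooting
  along. Hence code sets of weighted trees coincide or are disjoint.\<close>

lemma weighted_iso_iff:
  fixes S :: "'a weighted_graph" and T :: "'b weighted_graph"
  assumes S: "weighted_tree S" and T: "weighted_tree T"
  shows "weighted_iso S T \<longleftrightarrow> code_set S = code_set T"
    and "code_set S \<inter> code_set T \<noteq> {} \<Longrightarrow> code_set S = code_set T"
proof -
  have iso_sub: "code_set S \<subseteq> code_set T" if "weighted_iso S T"
    for S :: "'c weighted_graph" and T :: "'d weighted_graph"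
  proof
    fix t assume "t \<in> code_set S"
    then obtain v where v: "tree_codes S v t" by (auto simp: code_set_def)
    obtain i where "weighted_isomorphism i S T" using \<open>weighted_iso S T\<close> by (auto simp: weighted_iso_def)
    note i = weighted_isomorphism_tree_map[OF this, unfolded tree_map_def]
    have "codes (weight T) (iso_verts i v) (iso_verts i ` vertices S)
       (map_prod (iso_verts i) (iso_verts i) ` parcs (skeleton S)) t"
      using codes_transport[OF v, of "iso_verts i" "weight T"] i by blast
    then show "t \<in> code_set T" using i by (auto simp: code_set_def)
  qed
  have common_iso: "weighted_iso S T" if "code_set S \<inter> code_set T \<noteq> {}"
    for S :: "'c weighted_graph" and T :: "'d weighted_graph"
  proof -
    obtain t v u where t: "tree_codes S v t" "tree_codes T u t"
      using \<open>code_set S \<inter> code_set T \<noteq> {}\<close> by (auto simp: code_set_def)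
    obtain h where "tree_map h (weight S) (vertices S) (parcs (skeleton S))
         (weight T) (vertices T) (parcs (skeleton T))"
      using codes_same_iso[OF t] by blast
    then show ?thesis
      using tree_map_weighted_isomorphism codes_arcs[OF t(1)] unfolding weighted_iso_def by blast
  qed
  show disj: "code_set S = code_set T" if ne: "code_set S \<inter> code_set T \<noteq> {}"
  proof
    show "code_set S \<subseteq> code_set T" by (rule iso_sub[OF common_iso[OF ne]])
    show "code_set T \<subseteq> code_set S"
      by (rule iso_sub[OF common_iso]) (use ne in \<open>simp add: Int_commute\<close>)
  qed
  show "weighted_iso S T \<longleftrightarrow> code_set S = code_set T"
  proof
    assume "weighted_iso S T"
    then have "code_set S \<inter> code_set T = code_set S" by (rule Int_absorb2[OF iso_sub])
    then show "code_set S = code_set T" using code_set_nonempty[OF S] by (intro disj) simp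
  next
    assume "code_set S = code_set T"
    then show "weighted_iso S T" using code_set_nonempty[OF S] by (intro common_iso) simp
  qed
qed

lemma code_set_wt: "t \<in> code_set T \<Longrightarrow> wt t = total_weight T"
  by (auto simp: code_set_def total_weight_def codes_wt)

lemma card_code_set_le:
  assumes "weighted_tree T"
  shows "card (code_set T) \<le> total_weight T"
proof -
  have fin: "finite (vertices T)" using weighted_treeD[OF assms] by (simp add: tree_on_def)
  have "code_set T \<subseteq> (\<lambda>v. THE t. tree_codes T v t) ` vertices T"
  proof
    fix t assume "t \<in> code_set T"
    then obtain v where v: "tree_codes T v t" by (auto simp: code_set_def)
    then have "(THE t. tree_codes T v t) = t" by (rule the_equality) (rule codes_unique[OF _ v])
    then show "t \<in> (\<lambda>v. THE t. tree_codes T v t) ` vertices T" using codes_root[OF v] by (intro image_eqI[of _ _ v]) simp_all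
  qed
  then have "card (code_set T) \<le> card (vertices T)" by (rule surj_card_le[OF fin])
  also have "\<dots> = (\<Sum>v \<in> vertices T. 1)" by simp
  also have "\<dots> \<le> total_weight T"
    unfolding total_weight_def
    by (rule sum_mono) (use assms in \<open>auto simp: weighted_tree_def Suc_le_eq\<close>)
  finally show ?thesis .
qed

lemma code_realized:
  assumes "wt t = n"
  shows "\<exists>T \<in> weighted_trees_of_weight n. t \<in> code_set T"
proof -
  \<comment> \<open>The first component of the pairing takes each value infinitely often, so this
    one weight function serves all codes.\<close>
  define w where "w x = Suc (fst (prod_decode x))" for x
  have "infinite {x. w x = Suc k}" for k
  proof
    assume "finite {x. w x = Suc k}"
    moreover have "range (\<lambda>j. prod_encode (k, j)) \<subseteq> {x. w x = Suc k}" by (auto simp: w_def)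
    ultimately have "finite (range (\<lambda>j. prod_encode (k, j)))" by (rule finite_subset[rotated])
    then show False by (auto simp: finite_image_iff inj_on_def)
  qed
  then obtain v V E where t: "codes w v V E t"
    using codes_exists[of w "{}" t] by blast
  let ?T = "\<lparr>skeleton = \<lparr>pverts = V, parcs = E\<rparr>, weight = w\<rparr>"
  have "weighted_tree ?T"
    using codes_tree_on[OF t] codes_positive[OF t] by (simp add: weighted_tree_def undirected_tree_iff)
  then have "?T \<in> weighted_trees_of_weight n"
    using codes_wt[OF t] assms by (simp add: weighted_trees_of_weight_def total_weight_def)
  moreover have "t \<in> code_set ?T" using t by (auto simp: code_set_def)
  ultimately show ?thesis by blast
qed

lemma pattern_has_limb:
  assumes T: "weighted_tree T" and t: "t \<in> code_set T" "has_pattern k0 M0 t"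
    and L: "tree_codes L r (Node k0 M0)"
  shows "has_limb T L r"
proof -
  obtain v where v: "tree_codes T v t" using t by (auto simp: code_set_def)
  have "hangs_at v (vertices T) (parcs (skeleton T)) (vertices T) (parcs (skeleton T))"
    by (simp add: hangs_at_def)
  from pattern_hanging[OF t(2) v this] obtain u U F where
    u: "codes (weight T) u U F (Node k0 M0)" "hangs_at u U F (vertices T) (parcs (skeleton T))" by blast
  obtain \<B> where B: "\<B> \<subseteq> branches T u"
      "limb T u \<B> = \<lparr>skeleton = \<lparr>pverts = U, parcs = F\<rparr>, weight = weight T\<rparr>"
    using hanging_limb[OF weighted_treeD[OF T] u] by blast
  obtain h where h: "tree_map h (weight T) U F (weight L) (vertices L) (parcs (skeleton L))" "h u = r"
    using codes_same_iso[OF u(1) L] by blast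
  have "rooted_weighted_iso (limb T u \<B>) u L r"
    unfolding rooted_weighted_iso_def
    using tree_map_weighted_isomorphism[of h "limb T u \<B>" L] h codes_arcs[OF u(1)] B(2) by auto
  moreover have "u \<in> vertices T" using u codes_root[OF u(1)] by (auto simp: hangs_at_def)
  ultimately show ?thesis unfolding has_limb_def using B(1) by blast
qed

section \<open>Counting isomorphism classes\<close>

definition num_rooted :: "nat \<Rightarrow> nat" where
  "num_rooted n = card {t. wt t = n}"

definition num_avoiding :: "nat \<Rightarrow> rtree multiset \<Rightarrow> nat \<Rightarrow> nat" where
  "num_avoiding k0 M0 n = card {t. wt t = n \<and> \<not> has_pattern k0 M0 t}"

definition class_codes :: "nat weighted_graph set \<Rightarrow> rtree set" where
  "class_codes C = (\<Union>T \<in> C. code_set T)"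

lemma unlabelled_class:
  assumes "C \<in> unlabelled_weighted_trees n"
  shows "\<exists>S \<in> weighted_trees_of_weight n.
    C = {T \<in> weighted_trees_of_weight n. code_set T = code_set S} \<and> class_codes C = code_set S"
proof -
  obtain S where S: "S \<in> weighted_trees_of_weight n"
    "C = {(S, T) \<in> weighted_trees_of_weight n \<times> weighted_trees_of_weight n. weighted_iso S T} `` {S}"
    using assms unfolding unlabelled_weighted_trees_def by (rule quotientE)
  have "C = {T \<in> weighted_trees_of_weight n. code_set T = code_set S}"
    unfolding S(2) using S(1) weighted_iso_iff(1)[of S]
    by (auto simp: weighted_trees_of_weight_def)
  moreover from this have "class_codes C = code_set S"
    unfolding class_codes_def using S(1) by blast
  ultimately show ?thesis using S(1) by blast
qed

lemma class_in_unlabelled: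
  assumes "S \<in> weighted_trees_of_weight n"
  shows "\<exists>C \<in> unlabelled_weighted_trees n. S \<in> C"
proof -
  let ?r = "{(S, T) \<in> weighted_trees_of_weight n \<times> weighted_trees_of_weight n. weighted_iso S T}"
  have "?r `` {S} \<in> unlabelled_weighted_trees n"
    unfolding unlabelled_weighted_trees_def by (rule quotientI[OF assms])
  moreover have "S \<in> ?r `` {S}"
    using assms weighted_iso_iff(1)[of S S] by (simp add: weighted_trees_of_weight_def)
  ultimately show ?thesis by (rule rev_bexI)
qed

lemma class_codes_disjoint:
  assumes "C \<in> unlabelled_weighted_trees n" "D \<in> unlabelled_weighted_trees n"
    and "class_codes C \<inter> class_codes D \<noteq> {}"
  shows "C = D"
proof -
  obtain S where S: "S \<in> weighted_trees_of_weight n"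
    "C = {T \<in> weighted_trees_of_weight n. code_set T = code_set S}" "class_codes C = code_set S"
    using unlabelled_class[OF assms(1)] by blast
  obtain S' where S': "S' \<in> weighted_trees_of_weight n"
    "D = {T \<in> weighted_trees_of_weight n. code_set T = code_set S'}" "class_codes D = code_set S'"
    using unlabelled_class[OF assms(2)] by blast
  have "code_set S = code_set S'"
    by (rule weighted_iso_iff(2))
      (use S(1) S'(1) assms(3) S(3) S'(3) in \<open>auto simp: weighted_trees_of_weight_def\<close>)
  then show ?thesis using S(2) S'(2) by simp
qed

lemma class_codes_props:
  assumes "C \<in> unlabelled_weighted_trees n"
  shows "class_codes C \<noteq> {}" "class_codes C \<subseteq> {t. wt t = n}" "card (class_codes C) \<le> n"
proof -
  obtain S where S: "S \<in> weighted_trees_of_weight n" "class_codes C = code_set S"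
    using unlabelled_class[OF assms] by blast
  then have S': "weighted_tree S" "total_weight S = n" by (simp_all add: weighted_trees_of_weight_def)
  show "class_codes C \<noteq> {}" using code_set_nonempty[OF S'(1)] S by simp
  show "class_codes C \<subseteq> {t. wt t = n}" using code_set_wt[of _ S] S' S by auto
  show "card (class_codes C) \<le> n" using card_code_set_le[OF S'(1)] S S' by simp
qed

text \<open>Picking one code from each class is injective, because different classes have disjoint
  code sets.\<close>

lemma card_classes_le:
  assumes X: "X \<subseteq> unlabelled_weighted_trees n"
    and Y: "finite Y" "\<And>C. C \<in> X \<Longrightarrow> class_codes C \<subseteq> Y"
  shows "finite X" "card X \<le> card Y"
proof -
  define f where "f C = (SOME t. t \<in> class_codes C)" for C
  have f: "f C \<in> class_codes C" if "C \<in> X" for C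
    unfolding f_def using class_codes_props(1)[of C n] X that by (simp add: some_in_eq subsetD)
  have inj: "inj_on f X"
  proof (rule inj_onI)
    fix C D assume "C \<in> X" "D \<in> X" "f C = f D"
    then show "C = D" using class_codes_disjoint[of C n D] f[of C] f[of D] X by auto
  qed
  have sub: "f ` X \<subseteq> Y" using f Y(2) by blast
  show "finite X" using inj_on_finite[OF inj sub Y(1)] .
  show "card X \<le> card Y" using card_inj_on_le[OF inj sub Y(1)] .
qed

lemma finite_unlabelled_weighted_trees: "finite (unlabelled_weighted_trees n)"
  using card_classes_le(1)[OF order_refl finite_wt_eq[of n "\<lambda>_. True"]] class_codes_props(2)[of _ n]
  by simp

lemma num_rooted_le: "num_rooted n \<le> n * card (unlabelled_weighted_trees n)"
proof -
  have "{t. wt t = n} \<subseteq> (\<Union>C \<in> unlabelled_weighted_trees n. class_codes C)"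
  proof
    fix t assume "t \<in> {t. wt t = n}"
    then obtain T where T: "T \<in> weighted_trees_of_weight n" "t \<in> code_set T"
      using code_realized[of t n] by auto
    then obtain C where "C \<in> unlabelled_weighted_trees n" "T \<in> C" using class_in_unlabelled by blast
    then show "t \<in> (\<Union>C \<in> unlabelled_weighted_trees n. class_codes C)"
      using T(2) by (auto simp: class_codes_def)
  qed
  moreover have "finite (class_codes C)" if "C \<in> unlabelled_weighted_trees n" for C
    using finite_subset[OF class_codes_props(2)[OF that] finite_wt_eq[of n "\<lambda>_. True", simplified]] .
  ultimately have "num_rooted n \<le> card (\<Union>C \<in> unlabelled_weighted_trees n. class_codes C)"
    unfolding num_rooted_def using finite_unlabelled_weighted_trees by (intro card_mono) auto
  also have "\<dots> \<le> (\<Sum>C \<in> unlabelled_weighted_trees n. card (class_codes C))"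
    using finite_unlabelled_weighted_trees by (rule card_UN_le)
  also have "\<dots> \<le> (\<Sum>C \<in> unlabelled_weighted_trees n. n)"
    by (intro sum_mono class_codes_props(3))
  finally show ?thesis by (simp add: mult.commute)
qed

text \<open>A single rooting with the pattern would give some tree of the class the limb. Only an
  inequality results, since a limb may also use the branch towards the root, where
  \<open>has_pattern\<close> does not look.\<close>

lemma card_limbless_le:
  assumes L: "tree_codes L r (Node k0 M0)"
  shows "card {C \<in> unlabelled_weighted_trees n. \<not> (\<exists>T \<in> C. has_limb T L r)} \<le> num_avoiding k0 M0 n"
  unfolding num_avoiding_def
proof (rule card_classes_le(2)[of _ n])
  fix C assume "C \<in> {C \<in> unlabelled_weighted_trees n. \<not> (\<exists>T \<in> C. has_limb T L r)}"
  then have C: "C \<in> unlabelled_weighted_trees n" and no: "\<And>T. T \<in> C \<Longrightarrow> \<not> has_limb T L r" by auto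
  obtain S where S: "S \<in> weighted_trees_of_weight n"
    "C = {T \<in> weighted_trees_of_weight n. code_set T = code_set S}" "class_codes C = code_set S"
    using unlabelled_class[OF C] by blast
  then have "S \<in> C" "weighted_tree S" by (simp_all add: weighted_trees_of_weight_def)
  then have "\<not> has_pattern k0 M0 t" if "t \<in> class_codes C" for t
    using pattern_has_limb[of S t k0 M0 L r] that S(3) L no by auto
  then show "class_codes C \<subseteq> {t. wt t = n \<and> \<not> has_pattern k0 M0 t}"
    using class_codes_props(2)[OF C] by auto
qed (auto simp: finite_wt_eq)

lemma limb_proportion_lower:
  assumes L: "tree_codes L r (Node k0 M0)" and pos: "0 < num_rooted n"
  shows "1 - real n * real (num_avoiding k0 M0 n) / real (num_rooted n) \<le> limb_proportion L r n"
    and "limb_proportion L r n \<le> 1"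
proof -
  let ?U = "unlabelled_weighted_trees n"
  let ?G = "{C \<in> ?U. \<exists>T \<in> C. has_limb T L r}" and ?B = "{C \<in> ?U. \<not> (\<exists>T \<in> C. has_limb T L r)}"
  have "card ?U = card ?G + card ?B"
    by (subst card_Un_disjoint[symmetric])
      (auto simp: finite_unlabelled_weighted_trees intro: arg_cong[where f = card])
  moreover have U: "num_rooted n \<le> n * card ?U" by (rule num_rooted_le)
  then have Upos: "0 < card ?U" using pos by (metis gr0I less_nat_zero_code mult_0_right not_le)
  ultimately have "real (card ?G) = real (card ?U) - real (card ?B)" by linarith
  then have eq: "limb_proportion L r n = 1 - real (card ?B) / real (card ?U)"
    unfolding limb_proportion_def using Upos by (simp only: diff_divide_distrib) simp
  then show "limb_proportion L r n \<le> 1" by simp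
  have cross_mult: "b / u \<le> m * a / q" if "b * q \<le> a * (m * u)" "0 < u" "0 < q" for a b m q u :: real
    using that by (simp add: field_simps)
  have "real (card ?B) * real (num_rooted n) \<le> real (num_avoiding k0 M0 n) * (real n * real (card ?U))"
    using card_limbless_le[OF L, of n] U by (intro mult_mono) (simp_all flip: of_nat_mult)
  then have "real (card ?B) / real (card ?U) \<le> real n * real (num_avoiding k0 M0 n) / real (num_rooted n)"
    using pos Upos cross_mult by simp
  then show "1 - real n * real (num_avoiding k0 M0 n) / real (num_rooted n) \<le> limb_proportion L r n"
    using eq by simp
qed

lemma limb_proportion_tendsto:
  assumes L: "tree_codes L r (Node k0 M0)"
    and pos: "\<And>n. 0 < n \<Longrightarrow> 0 < num_rooted n"
    and lim: "(\<lambda>n. real n * real (num_avoiding k0 M0 n) / real (num_rooted n)) \<longlonglongrightarrow> 0"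
  shows "limb_proportion L r \<longlonglongrightarrow> 1"
proof (rule tendsto_sandwich)
  show "(\<lambda>n. 1 - real n * real (num_avoiding k0 M0 n) / real (num_rooted n)) \<longlonglongrightarrow> 1"
    using tendsto_diff[OF tendsto_const lim, of 1] by simp
  show "\<forall>\<^sub>F n in sequentially. 1 - real n * real (num_avoiding k0 M0 n) / real (num_rooted n)
      \<le> limb_proportion L r n"
    using eventually_gt_at_top[of 0] by eventually_elim (use limb_proportion_lower[OF L pos] in auto)
  show "\<forall>\<^sub>F n in sequentially. limb_proportion L r n \<le> 1"
    using eventually_gt_at_top[of 0] by eventually_elim (use limb_proportion_lower[OF L pos] in auto)
qed simp

section \<open>Generating functions\<close>

abbreviation forest_wt :: "rtree multiset \<Rightarrow> nat" where
  "forest_wt M \<equiv> sum_mset (image_mset wt M)"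

lemma has_sum_times:
  fixes f :: "'a \<Rightarrow> real" and g :: "'b \<Rightarrow> real"
  assumes f: "(f has_sum a) A" and g: "(g has_sum b) B"
    and "\<And>p. p \<in> A \<Longrightarrow> 0 \<le> f p" "\<And>q. q \<in> B \<Longrightarrow> 0 \<le> g q"
  shows "((\<lambda>(p, q). f p * g q) has_sum (a * b)) (A \<times> B)"
proof (rule has_sum_SigmaI)
  show *: "((\<lambda>q. case (p, q) of (p, q) \<Rightarrow> f p * g q) has_sum (f p * b)) B" if "p \<in> A" for p
    using has_sum_cmult_right[OF g, of "f p"] by simp
  show **: "((\<lambda>p. f p * b) has_sum (a * b)) A" by (rule has_sum_cmult_left[OF f])
  show "(\<lambda>(p, q). f p * g q) summable_on A \<times> B"
    by (rule summable_on_SigmaI[OF *])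
      (use assms(3,4) has_sum_imp_summable[OF **] in auto)
qed

text \<open>The Euler product for multisets over \<open>S\<close>: each factor is the geometric
  series over the multiplicity of one tree.\<close>

definition mset_gf :: "rtree set \<Rightarrow> real \<Rightarrow> real" where
  "mset_gf S x = (\<Prod>t \<in> S. 1 / (1 - x ^ wt t))"

lemma has_sum_geometric:
  fixes x :: real
  assumes "0 \<le> x" "x < 1"
  shows "((\<lambda>j. x ^ j) has_sum (1 / (1 - x))) UNIV"
  using assms by (intro sums_nonneg_imp_has_sum geometric_sums) auto

lemma has_sum_forests:
  assumes "finite S" "0 < x" "x < 1"
  shows "((\<lambda>M. x ^ forest_wt M) has_sum mset_gf S x) {M. set_mset M \<subseteq> S}"
  using assms(1)
proof induction
  case empty
  then show ?case by (intro has_sum_finiteI) (auto simp: mset_gf_def)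
next
  case (insert t S)
  have y: "0 < x ^ wt t" "x ^ wt t < 1"
    using assms wt_pos[of t] by (auto simp: power_less_one_iff)
  have "((\<lambda>(j, M). (x ^ wt t) ^ j * x ^ forest_wt M) has_sum (1 / (1 - x ^ wt t) * mset_gf S x))
     (UNIV \<times> {M. set_mset M \<subseteq> S})"
    using y assms by (intro has_sum_times has_sum_geometric insert.IH) auto
  also have "?this \<longleftrightarrow> ((\<lambda>M. x ^ forest_wt M) has_sum mset_gf (insert t S) x) {M. set_mset M \<subseteq> insert t S}"
  proof (rule has_sum_reindex_bij_witness[of _ "\<lambda>M. (count M t, filter_mset (\<lambda>s. s \<noteq> t) M)"
        "\<lambda>(j, M). replicate_mset j t + M"])
    fix p :: "nat \<times> rtree multiset"
    assume "p \<in> UNIV \<times> {M. set_mset M \<subseteq> S}"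
    then obtain j M where p: "p = (j, M)" and M: "set_mset M \<subseteq> S" by auto
    then have "t \<notin># M" using insert.hyps(2) by auto
    moreover from this have "filter_mset (\<lambda>s. s \<noteq> t) M = M"
      by (intro multiset_eqI) (auto simp: not_in_iff)
    ultimately show "(count ((\<lambda>(j, M). replicate_mset j t + M) p) t,
        filter_mset (\<lambda>s. s \<noteq> t) ((\<lambda>(j, M). replicate_mset j t + M) p)) = p"
      unfolding p by (simp add: not_in_iff)
    show "x ^ forest_wt ((\<lambda>(j, M). replicate_mset j t + M) p) =
        (case p of (j, M) \<Rightarrow> (x ^ wt t) ^ j * x ^ forest_wt M)"
      unfolding p by (simp add: power_add flip: power_mult) (simp add: mult.commute)
    show "(\<lambda>(j, M). replicate_mset j t + M) p \<in> {M. set_mset M \<subseteq> insert t S}"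
      using p M by (auto split: if_splits)
  next
    fix M assume "M \<in> {M. set_mset M \<subseteq> insert t S}"
    then show "(count M t, filter_mset (\<lambda>s. s \<noteq> t) M) \<in> UNIV \<times> {M. set_mset M \<subseteq> S}" by auto
    show "(\<lambda>(j, M). replicate_mset j t + M) (count M t, filter_mset (\<lambda>s. s \<noteq> t) M) = M"
      by (rule multiset_eqI) auto
  next
    show "1 / (1 - x ^ wt t) * mset_gf S x = mset_gf (insert t S) x"
      using insert.hyps by (simp add: mset_gf_def)
  qed
  finally show ?case .
qed

definition trees_over :: "rtree set \<Rightarrow> rtree set" where
  "trees_over S = {Node k M | k M. set_mset M \<subseteq> S}"

text \<open>The factor \<open>x / (1 - x)\<close> sums \<open>x ^ Suc k\<close> over the possible
  root weights.\<close>

lemma has_sum_trees_over: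
  assumes "finite S" "0 < x" "x < 1"
  shows "((\<lambda>t. x ^ wt t) has_sum (x / (1 - x) * mset_gf S x)) (trees_over S)"
proof -
  have "((\<lambda>k. x * x ^ k) has_sum (x * (1 / (1 - x)))) (UNIV :: nat set)"
    using assms by (intro has_sum_cmult_right has_sum_geometric) auto
  then have "((\<lambda>(k, M). x * x ^ k * x ^ forest_wt M) has_sum (x * (1 / (1 - x)) * mset_gf S x))
     (UNIV \<times> {M. set_mset M \<subseteq> S})"
    using assms by (intro has_sum_times has_sum_forests) auto
  also have "?this \<longleftrightarrow> ?thesis"
    by (rule has_sum_reindex_bij_witness[of _ "\<lambda>t. case t of Node k M \<Rightarrow> (k, M)" "\<lambda>(k, M). Node k M"])
      (auto simp: trees_over_def power_add)
  finally show ?thesis .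
qed

lemma has_sum_pattern_at_root:
  assumes "finite S" "0 < x" "x < 1"
  shows "((\<lambda>t. x ^ wt t) has_sum (x ^ wt (Node k0 M0) * mset_gf S x))
    ((\<lambda>M. Node k0 (M0 + M)) ` {M. set_mset M \<subseteq> S})"
proof -
  have "((\<lambda>M. x ^ wt (Node k0 M0) * x ^ forest_wt M) has_sum (x ^ wt (Node k0 M0) * mset_gf S x))
     {M. set_mset M \<subseteq> S}"
    by (rule has_sum_cmult_right[OF has_sum_forests[OF assms]])
  moreover have "inj_on (\<lambda>M. Node k0 (M0 + M)) {M. set_mset M \<subseteq> S}" by (auto intro: inj_onI)
  ultimately show ?thesis by (subst has_sum_reindex) (simp_all add: o_def power_add mult_ac)
qed

abbreviation trees_upto :: "nat \<Rightarrow> rtree set" where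
  "trees_upto N \<equiv> {t. wt t \<le> N}"

text \<open>Children are lighter than their tree by at least 1. The right-hand side also counts
  heavier trees over the same children, hence an inequality.\<close>

lemma sum_trees_upto_le:
  assumes "0 < x" "x < 1"
  shows "(\<Sum>t \<in> trees_upto (Suc N). x ^ wt t) \<le> x / (1 - x) * mset_gf (trees_upto N) x"
proof (rule finite_sum_le_has_sum[OF has_sum_trees_over[OF finite_wt_le assms] finite_wt_le])
  show "trees_upto (Suc N) \<subseteq> trees_over (trees_upto N)"
  proof
    fix t assume t: "t \<in> trees_upto (Suc N)"
    obtain k M where "t = Node k M" by (cases t)
    moreover have "wt s \<le> N" if "s \<in># M" for s
      using wt_child_less[OF that, of k] t \<open>t = Node k M\<close> by simp
    ultimately show "t \<in> trees_over (trees_upto N)" by (auto simp: trees_over_def)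
  qed
qed (use assms in auto)

text \<open>The family \<open>trees_over S\<close> is infinite, but each finite part of it lies in
  some \<open>trees_upto N\<close>. This supplies the estimate opposite to
  \<open>sum_trees_upto_le\<close>.\<close>

lemma mset_gf_le_bound:
  assumes "0 < x" "x < 1" and B: "\<And>N. (\<Sum>t \<in> trees_upto N. x ^ wt t) \<le> B" and "finite S"
  shows "x / (1 - x) * mset_gf S x \<le> B"
proof (rule has_sum_le_finite_sums[OF has_sum_trees_over[OF \<open>finite S\<close> assms(1,2)]])
  fix F assume F: "finite F" "F \<subseteq> trees_over S"
  have "F \<subseteq> trees_upto (Max (insert 0 (wt ` F)))" using F(1) by auto
  then have "(\<Sum>t \<in> F. x ^ wt t) \<le> (\<Sum>t \<in> trees_upto (Max (insert 0 (wt ` F))). x ^ wt t)"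
    using assms by (intro sum_mono2 finite_wt_le) auto
  also have "\<dots> \<le> B" by (rule B)
  finally show "(\<Sum>t \<in> F. x ^ wt t) \<le> B" .
qed

lemma has_pattern_wt: "has_pattern k0 M0 t \<Longrightarrow> wt (Node k0 M0) \<le> wt t"
proof (induction rule: has_pattern.induct)
  case (below s M k)
  then show ?case using wt_child_less[of s M k] by linarith
qed simp

abbreviation avoiding_upto :: "nat \<Rightarrow> rtree multiset \<Rightarrow> nat \<Rightarrow> rtree set" where
  "avoiding_upto k0 M0 N \<equiv> {t. wt t \<le> N \<and> \<not> has_pattern k0 M0 t}"

lemma finite_avoiding_upto: "finite (avoiding_upto k0 M0 N)"
  by (rule finite_subset[OF _ finite_wt_le[of N]]) auto

text \<open>Avoiding trees have avoiding children and, in addition, do not show the pattern at the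
  root; the second condition removes the family of \<open>has_sum_pattern_at_root\<close>.\<close>

lemma sum_avoiding_upto_le:
  assumes x: "0 < x" "x < 1" and N: "wt (Node k0 M0) \<le> N"
  shows "(\<Sum>t \<in> avoiding_upto k0 M0 (Suc N). x ^ wt t) \<le>
    (x / (1 - x) - x ^ wt (Node k0 M0)) * mset_gf (avoiding_upto k0 M0 N) x"
proof -
  let ?S = "avoiding_upto k0 M0 N"
  let ?D = "(\<lambda>M. Node k0 (M0 + M)) ` {M. set_mset M \<subseteq> ?S}"
  \<comment> \<open>The family \<open>?D\<close> can be subtracted only if it lies in
    \<open>trees_over ?S\<close>. The children in \<open>M0\<close> are too light to contain the
    pattern, and \<open>N\<close> is large enough to include them.\<close>
  have M0: "set_mset M0 \<subseteq> ?S"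
  proof
    fix s assume "s \<in># M0"
    then have "wt s < wt (Node k0 M0)" by (rule wt_child_less)
    then show "s \<in> ?S" using has_pattern_wt[of k0 M0 s] N by auto
  qed
  have "?D \<subseteq> trees_over ?S" using M0 by (force simp: trees_over_def)
  with has_sum_trees_over[OF finite_avoiding_upto x] has_sum_pattern_at_root[OF finite_avoiding_upto x]
  have "((\<lambda>t. x ^ wt t) has_sum (x / (1 - x) * mset_gf ?S x - x ^ wt (Node k0 M0) * mset_gf ?S x))
      (trees_over ?S - ?D)"
    by (rule has_sum_Diff)
  then have *: "((\<lambda>t. x ^ wt t) has_sum ((x / (1 - x) - x ^ wt (Node k0 M0)) * mset_gf ?S x))
      (trees_over ?S - ?D)"
    by (simp only: left_diff_distrib)
  show ?thesis
  proof (rule finite_sum_le_has_sum[OF * finite_avoiding_upto])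
    show "avoiding_upto k0 M0 (Suc N) \<subseteq> trees_over ?S - ?D"
    proof
      fix t assume t: "t \<in> avoiding_upto k0 M0 (Suc N)"
      obtain k M where tk: "t = Node k M" by (cases t)
      have "s \<in> ?S" if "s \<in># M" for s
        using wt_child_less[OF that, of k] t has_pattern.below[OF _ that, of k0 M0 k] unfolding tk by auto
      then have "t \<in> trees_over ?S" unfolding tk by (auto simp: trees_over_def)
      moreover have "t \<notin> ?D" using t by (auto intro: has_pattern.here)
      ultimately show "t \<in> trees_over ?S - ?D" by simp
    qed
  qed (use x in auto)
qed

text \<open>The factor of a tree of weight \<open>n\<close> is \<open>exp (x ^ n + lg (x ^ n))\<close>; the quadratic remainder \<open>lg\<close>
  still converges beyond the radius of convergence of the first summand.\<close>

definition lg :: "real \<Rightarrow> real" where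
  "lg y = - ln (1 - y) - y"

lemma lg_nonneg: "0 \<le> y \<Longrightarrow> y < 1 \<Longrightarrow> 0 \<le> lg y"
  using ln_add_one_self_le_self2[of "- y"] by (simp add: lg_def)

lemma lg_le: "0 \<le> y \<Longrightarrow> y < 1 \<Longrightarrow> lg y \<le> y\<^sup>2 / (1 - y)"
proof -
  assume y: "0 \<le> y" "y < 1"
  then have "- ln (1 - y) = ln (1 / (1 - y))" by (simp add: ln_div)
  also have "\<dots> \<le> 1 / (1 - y) - 1" using y by (intro ln_le_minus_one) simp
  also have "\<dots> = y\<^sup>2 / (1 - y) + y" using y by (simp add: field_simps power2_eq_square)
  finally show ?thesis by (simp add: lg_def)
qed

lemma mset_gf_exp:
  assumes "finite S" "0 < x" "x < 1"
  shows "mset_gf S x = exp ((\<Sum>t \<in> S. x ^ wt t) + (\<Sum>t \<in> S. lg (x ^ wt t)))"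
proof -
  have "1 / (1 - x ^ wt t) = exp (x ^ wt t + lg (x ^ wt t))" for t
  proof -
    have "x ^ wt t < 1" using assms wt_pos[of t] by (simp add: power_less_one_iff)
    then show ?thesis by (simp add: lg_def exp_minus inverse_eq_divide)
  qed
  then show ?thesis
    using assms(1) by (simp add: mset_gf_def exp_sum flip: sum.distrib)
qed

lemma sum_trees_upto:
  fixes f :: "nat \<Rightarrow> real"
  shows "(\<Sum>t \<in> trees_upto N. f (wt t)) = (\<Sum>n \<le> N. real (num_rooted n) * f n)"
proof -
  have "(\<Sum>t \<in> trees_upto N. f (wt t)) = (\<Sum>n \<le> N. \<Sum>t \<in> {t \<in> trees_upto N. wt t = n}. f (wt t))"
    by (rule sum.group[symmetric]) (auto simp: finite_wt_le)
  also have "\<dots> = (\<Sum>n \<le> N. real (num_rooted n) * f n)"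
  proof (rule sum.cong[OF refl])
    fix n assume "n \<in> {..N}"
    then have "{t \<in> trees_upto N. wt t = n} = {t. wt t = n}" by auto
    then show "(\<Sum>t \<in> {t \<in> trees_upto N. wt t = n}. f (wt t)) = real (num_rooted n) * f n"
      by (simp add: num_rooted_def)
  qed
  finally show ?thesis .
qed

section \<open>Growth of the number of rooted trees\<close>

lemma num_rooted_pos:
  assumes "0 < n"
  shows "0 < num_rooted n"
proof -
  have "Node (n - 1) {#} \<in> {t. wt t = n}" using assms by simp
  moreover have "finite {t. wt t = n}" using finite_wt_eq[of n "\<lambda>_. True"] by simp
  ultimately show ?thesis unfolding num_rooted_def card_gt_0_iff by blast
qed

lemma num_rooted_0 [simp]: "num_rooted 0 = 0"
proof -
  have "wt t \<noteq> 0" for t using wt_pos[of t] by simp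
  then have "{t. wt t = 0} = {}" by blast
  then show ?thesis unfolding num_rooted_def by (simp only: card.empty)
qed

text \<open>Two trees are joined under a root of weight 1. By \<open>m \<noteq> n\<close> the
  children are told apart by their weights, so the unordered pair determines the ordered
  one.\<close>

lemma num_rooted_mult_le:
  assumes "m \<noteq> n"
  shows "num_rooted m * num_rooted n \<le> num_rooted (Suc (m + n))"
proof -
  let ?f = "\<lambda>(s, t). Node 0 {#s, t#}"
  have "inj_on ?f ({s. wt s = m} \<times> {t. wt t = n})"
    using assms by (auto simp: inj_on_def add_eq_conv_ex)
  moreover have "?f ` ({s. wt s = m} \<times> {t. wt t = n}) \<subseteq> {t. wt t = Suc (m + n)}" by auto
  moreover have "finite {t. wt t = Suc (m + n)}" using finite_wt_eq[of _ "\<lambda>_. True"] by simp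
  ultimately have "card ({s. wt s = m} \<times> {t. wt t = n}) \<le> card {t. wt t = Suc (m + n)}"
    by (rule card_inj_on_le)
  then show ?thesis by (simp add: num_rooted_def card_cartesian_product)
qed

definition rooted_gf_converges :: "real \<Rightarrow> bool" where
  "rooted_gf_converges x \<longleftrightarrow> summable (\<lambda>n. real (num_rooted n) * x ^ n)"

text \<open>The logarithm of the factor E of the overview.\<close>

definition lg_sum :: "real \<Rightarrow> real" where
  "lg_sum x = (\<Sum>n. real (num_rooted n) * lg (x ^ n))"

text \<open>Bounds the terms of \<open>lg_sum x\<close> by those of the counting series at
  \<open>x\<^sup>2\<close>, with a denominator independent of \<open>n\<close>.\<close>

lemma lg_power_le:
  assumes "0 \<le> x" "x < 1" "0 < n"
  shows "lg (x ^ n) \<le> (x\<^sup>2) ^ n / (1 - x)"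
proof -
  obtain m where n: "n = Suc m" using assms(3) by (cases n) auto
  have le: "x ^ n \<le> x" using assms by (simp add: n mult_left_le power_le_one)
  then have "lg (x ^ n) \<le> (x ^ n)\<^sup>2 / (1 - x ^ n)" using assms by (intro lg_le) auto
  also have "\<dots> \<le> (x ^ n)\<^sup>2 / (1 - x)" using le assms by (intro divide_left_mono) auto
  finally show ?thesis by (simp add: mult.commute flip: power_mult)
qed

lemma lg_term_bounds:
  assumes "0 \<le> x" "x < 1"
  shows "0 \<le> real (num_rooted n) * lg (x ^ n)"
    and "real (num_rooted n) * lg (x ^ n) \<le> real (num_rooted n) * (x\<^sup>2) ^ n / (1 - x)"
proof -
  show "0 \<le> real (num_rooted n) * lg (x ^ n)"
    using assms by (cases n) (auto intro!: mult_nonneg_nonneg lg_nonneg simp: power_less_one_iff simp del: power_Suc)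
  show "real (num_rooted n) * lg (x ^ n) \<le> real (num_rooted n) * (x\<^sup>2) ^ n / (1 - x)"
  proof (cases "n = 0")
    case False
    then have "lg (x ^ n) \<le> (x\<^sup>2) ^ n / (1 - x)" using assms by (intro lg_power_le) auto
    from mult_left_mono[OF this, of "real (num_rooted n)"] show ?thesis
      unfolding times_divide_eq_right by simp
  qed simp
qed

lemma summable_lg_terms:
  assumes "0 \<le> x" "x < 1" "rooted_gf_converges (x\<^sup>2)"
  shows "summable (\<lambda>n. real (num_rooted n) * lg (x ^ n))"
proof (rule summable_comparison_test')
  show "summable (\<lambda>n. real (num_rooted n) * (x\<^sup>2) ^ n / (1 - x))"
    using assms(3) unfolding rooted_gf_converges_def by (rule summable_divide)
  show "norm (real (num_rooted n) * lg (x ^ n)) \<le> real (num_rooted n) * (x\<^sup>2) ^ n / (1 - x)" for n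
    using lg_term_bounds[OF assms(1,2), of n] by simp
qed

lemma rooted_gf_converges_mono:
  assumes "rooted_gf_converges y" "0 \<le> x" "x \<le> y"
  shows "rooted_gf_converges x"
  unfolding rooted_gf_converges_def
proof (rule summable_comparison_test')
  show "summable (\<lambda>n. real (num_rooted n) * y ^ n)" using assms(1) by (simp add: rooted_gf_converges_def)
  show "norm (real (num_rooted n) * x ^ n) \<le> real (num_rooted n) * y ^ n" for n
    using assms(2,3) by (auto intro!: mult_left_mono power_mono)
qed

lemma sum_upto_step:
  assumes "0 < x" "x < 1"
  shows "(\<Sum>n \<le> Suc N. real (num_rooted n) * x ^ n) \<le> x / (1 - x) *
    exp ((\<Sum>n \<le> N. real (num_rooted n) * x ^ n) + (\<Sum>n \<le> N. real (num_rooted n) * lg (x ^ n)))"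
  using sum_trees_upto_le[OF assms, of N] mset_gf_exp[OF finite_wt_le assms, of N]
    sum_trees_upto[of "\<lambda>n. x ^ n"] sum_trees_upto[of "\<lambda>n. lg (x ^ n)"] by simp

text \<open>With \<open>R\<close> for the sum of the series, the functional equation reads
  \<open>R = x / (1 - x) * exp (R + lg_sum x)\<close>, and \<open>R * exp (- R) \<le> exp (- 1)\<close>.\<close>

lemma rooted_gf_bounds:
  assumes x: "0 < x" "x < 1" and conv: "rooted_gf_converges x"
  shows "x / (1 - x) * exp (lg_sum x) \<le> exp (- 1)"
    and "(\<Sum>n \<le> N. real (num_rooted n) * x ^ n) \<le> 1"
proof -
  define R where "R = (\<Sum>n. real (num_rooted n) * x ^ n)"
  let ?F = "\<lambda>N. \<Sum>n \<le> N. real (num_rooted n) * x ^ n"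
  let ?H = "\<lambda>N. \<Sum>n \<le> N. real (num_rooted n) * lg (x ^ n)"
  have conv2: "rooted_gf_converges (x\<^sup>2)"
    using rooted_gf_converges_mono[OF conv, of "x\<^sup>2"] x by (simp add: power2_eq_square mult_left_le)
  note sumH = summable_lg_terms[OF less_imp_le[OF x(1)] x(2) conv2]
  have F: "?F \<longlonglongrightarrow> R"
    unfolding R_def using conv unfolding rooted_gf_converges_def by (rule summable_LIMSEQ')
  have H: "?H \<longlonglongrightarrow> lg_sum x"
    unfolding lg_sum_def by (rule summable_LIMSEQ'[OF sumH])
  have F_le: "?F N \<le> R" for N
    unfolding R_def using conv x by (intro sum_le_suminf) (auto simp: rooted_gf_converges_def)
  have "x / (1 - x) * exp (?F N + ?H N) \<le> R" for N
    using mset_gf_le_bound[OF x, of R "trees_upto N"] mset_gf_exp[OF finite_wt_le x, of N] F_le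
      sum_trees_upto[of "\<lambda>n. x ^ n"] sum_trees_upto[of "\<lambda>n. lg (x ^ n)"] finite_wt_le[of N] by simp
  moreover have "(\<lambda>N. x / (1 - x) * exp (?F N + ?H N)) \<longlonglongrightarrow> x / (1 - x) * exp (R + lg_sum x)"
    by (intro tendsto_intros F H)
  ultimately have "x / (1 - x) * exp (R + lg_sum x) \<le> R"
    by (intro LIMSEQ_le_const2) auto
  also have "R \<le> exp (R - 1)" using exp_ge_add_one_self[of "R - 1"] by simp
  finally have "x / (1 - x) * exp (lg_sum x) * exp R \<le> exp (- 1) * exp R"
    by (simp add: exp_add exp_diff exp_minus field_simps)
  then show psi: "x / (1 - x) * exp (lg_sum x) \<le> exp (- 1)"
    by (rule mult_right_le_imp_le) simp
  have H_le: "?H N \<le> lg_sum x" for N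
    unfolding lg_sum_def using lg_term_bounds(1)[of x] x by (intro sum_le_suminf sumH) auto
  \<comment> \<open>By \<open>psi\<close>, one step of the recursion is dominated by s -> exp (s -
    1), which fixes 1.\<close>
  show "?F N \<le> 1"
  proof (induction N)
    case (Suc N)
    have "?F (Suc N) \<le> x / (1 - x) * exp (?F N + ?H N)" by (rule sum_upto_step[OF x])
    also have "\<dots> \<le> x / (1 - x) * exp (1 + lg_sum x)"
      using Suc.IH H_le[of N] x by (intro mult_left_mono) auto
    also have "\<dots> = x / (1 - x) * exp (lg_sum x) * exp 1" by (simp add: exp_add)
    also have "\<dots> \<le> exp (- 1) * exp (1 :: real)" using psi by (rule mult_right_mono) simp
    finally show ?case by (simp add: exp_minus)
  qed simp
qed

lemma rooted_gf_convergesI: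
  assumes "0 \<le> x" "\<And>N. (\<Sum>n \<le> N. real (num_rooted n) * x ^ n) \<le> B"
  shows "rooted_gf_converges x"
  unfolding rooted_gf_converges_def
proof (rule summableI_nonneg_bounded)
  show "0 \<le> real (num_rooted n) * x ^ n" for n using assms(1) by simp
  show "(\<Sum>i<n. real (num_rooted i) * x ^ i) \<le> max 0 B" for n
    using assms(2)[of "n - 1"] by (cases n) (auto simp: lessThan_Suc_atMost)
qed

text \<open>Ensures a positive radius. At 1/10 each remainder is at most 1/9 of its term, so a
  partial sum of at most 1 gives an exponent of at most 10/9, and exp (10/9) <= 9 cancels the factor
  x / (1 - x) = 1/9.\<close>

lemma rooted_gf_converges_tenth: "rooted_gf_converges (1 / 10)"
proof (rule rooted_gf_convergesI)
  let ?x = "1 / 10 :: real"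
  let ?F = "\<lambda>N. \<Sum>n \<le> N. real (num_rooted n) * ?x ^ n"
  have x: "0 < ?x" "?x < 1" by auto
  have exp_bound: "exp (10 / 9 :: real) \<le> 9"
  proof -
    have "exp (10 / 9 :: real) \<le> exp (1 + 1)" by simp
    also have "\<dots> = exp 1 * exp 1" by (rule exp_add)
    also have "\<dots> \<le> 3 * 3" using exp_le by (intro mult_mono) auto
    finally show ?thesis by simp
  qed
  show "?F N \<le> 1" for N
  proof (induction N)
    case (Suc N)
    have "(\<Sum>n \<le> N. real (num_rooted n) * lg (?x ^ n)) \<le> (\<Sum>n \<le> N. real (num_rooted n) * ?x ^ n * (1 / 9))"
    proof (rule sum_mono)
      fix n
      show "real (num_rooted n) * lg (?x ^ n) \<le> real (num_rooted n) * ?x ^ n * (1 / 9)"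
      proof (cases "n = 0")
        case False
        have "lg (?x ^ n) \<le> (?x\<^sup>2) ^ n / (1 - ?x)" using False by (intro lg_power_le) auto
        also have "\<dots> = ?x ^ n * ?x ^ n / (1 - ?x)"
          by (simp only: power2_eq_square power_mult_distrib)
        also have "\<dots> \<le> ?x ^ n * ?x / (1 - ?x)"
          using power_decreasing[of 1 n ?x] False
          by (intro divide_right_mono mult_left_mono) simp_all
        finally have "lg (?x ^ n) \<le> ?x ^ n * (1 / 9)" by simp
        from mult_left_mono[OF this, of "real (num_rooted n)"] show ?thesis
          unfolding mult.assoc by simp
      qed simp
    qed
    also have "\<dots> = ?F N * (1 / 9)" by (rule sum_distrib_right[symmetric])
    finally have "?F N + (\<Sum>n \<le> N. real (num_rooted n) * lg (?x ^ n)) \<le> 10 / 9" using Suc.IH by simp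
    then have "?x / (1 - ?x) * exp (?F N + (\<Sum>n \<le> N. real (num_rooted n) * lg (?x ^ n)))
        \<le> ?x / (1 - ?x) * exp (10 / 9)"
      by (intro mult_left_mono) auto
    with sum_upto_step[OF x, of N] have "?F (Suc N) \<le> ?x / (1 - ?x) * exp (10 / 9)"
      by (rule order_trans)
    then show ?case using exp_bound by simp
  qed simp
qed simp

text \<open>Convergence at the supremum itself holds because the partial sums are bounded by 1
  throughout \<open>X\<close>, a closed condition on \<open>x\<close>.\<close>

lemma ex_radius:
  "\<exists>\<rho>. 0 < \<rho> \<and> \<rho> < 1 \<and> rooted_gf_converges \<rho> \<and> (\<forall>z. \<rho> < z \<longrightarrow> z < 1 \<longrightarrow> \<not> rooted_gf_converges z)"
proof -
  define X where "X = {x. 0 < x \<and> x < 1 \<and> rooted_gf_converges x}"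
  have X10: "1 / 10 \<in> X" using rooted_gf_converges_tenth by (simp add: X_def)
  \<comment> \<open>There are trees of weights 1 and 2, so x + x^2 <= 1, whereas 3/4 + 9/16 >
    1.\<close>
  have X_le: "x \<le> 3 / 4" if "x \<in> X" for x
  proof -
    have x: "0 < x" "x < 1" "rooted_gf_converges x" using that by (auto simp: X_def)
    have "(\<Sum>n \<in> {1, 2}. 1 * x ^ n) \<le> (\<Sum>n \<in> {1, 2}. real (num_rooted n) * x ^ n)"
      using num_rooted_pos x by (intro sum_mono mult_right_mono) (auto simp: Suc_le_eq)
    also have "\<dots> \<le> (\<Sum>n \<le> 2. real (num_rooted n) * x ^ n)" using x by (intro sum_mono2) auto
    also have "\<dots> \<le> 1" by (rule rooted_gf_bounds(2)[OF x])
    finally have "x + x\<^sup>2 \<le> 1" by simp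
    moreover have "(3 / 4)\<^sup>2 \<le> x\<^sup>2" if "3 / 4 < x"
      using that by (intro power_mono) auto
    ultimately show ?thesis by (fastforce simp: power2_eq_square)
  qed
  have bdd: "bdd_above X" using X_le by (meson bdd_aboveI)
  define \<rho> where "\<rho> = Sup X"
  have "1 / 10 \<le> \<rho>" unfolding \<rho>_def using X10 bdd by (rule cSup_upper)
  moreover have "\<rho> \<le> 3 / 4" unfolding \<rho>_def using X10 X_le by (intro cSup_least) auto
  moreover have "rooted_gf_converges \<rho>"
  proof (rule rooted_gf_convergesI)
    show "(\<Sum>n \<le> N. real (num_rooted n) * \<rho> ^ n) \<le> 1" for N
    proof -
      let ?C = "{x :: real. (\<Sum>n \<le> N. real (num_rooted n) * x ^ n) \<le> 1}"
      have "closed ?C" by (intro closed_Collect_le continuous_intros)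
      moreover have "X \<subseteq> ?C" using rooted_gf_bounds(2) by (auto simp: X_def)
      ultimately have "closure X \<subseteq> ?C" by (rule closure_minimal[rotated])
      moreover have "\<rho> \<in> closure X"
        unfolding \<rho>_def using X10 bdd by (intro closure_contains_Sup) auto
      ultimately show ?thesis by blast
    qed
  qed (use \<open>1 / 10 \<le> \<rho>\<close> in simp)
  moreover have "\<not> rooted_gf_converges z" if "\<rho> < z" "z < 1" for z
  proof
    assume "rooted_gf_converges z"
    then have "z \<in> X" using that \<open>1 / 10 \<le> \<rho>\<close> by (simp add: X_def)
    then have "z \<le> \<rho>" unfolding \<rho>_def using bdd by (rule cSup_upper)
    then show False using that by simp
  qed
  ultimately show ?thesis by (intro exI[of _ \<rho>]) simp
qed

text \<open>Divergence at \<open>y < z\<close> forces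
  \<open>1 \<le> real (num_rooted k) * z ^ Suc k\<close> for some \<open>k\<close>. Joining trees of
  weight \<open>k\<close> then raises the weight by \<open>Suc k\<close> without lowering the
  product of count and power of \<open>z\<close>.\<close>

lemma num_rooted_lower:
  assumes z: "0 < y" "y < z" "z < 1" and div: "\<not> rooted_gf_converges y"
  shows "\<exists>c k. 0 < c \<and> (\<forall>n. k < n \<longrightarrow> c \<le> real (num_rooted n) * z ^ n)"
proof -
  have "\<exists>k. 1 \<le> real (num_rooted k) * z ^ Suc k"
  proof (rule ccontr)
    assume "\<nexists>k. 1 \<le> real (num_rooted k) * z ^ Suc k"
    then have lt: "real (num_rooted k) * z ^ Suc k < 1" for k by (meson not_le)
    have "summable (\<lambda>n. real (num_rooted n) * y ^ n)"
    proof (rule summable_comparison_test')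
      show "summable (\<lambda>n. (1 / z) * (y / z) ^ n)" using z by (intro summable_mult summable_geometric) auto
      show "norm (real (num_rooted n) * y ^ n) \<le> (1 / z) * (y / z) ^ n" for n
      proof -
        have "real (num_rooted n) * z ^ Suc n * y ^ n \<le> 1 * y ^ n"
          using lt[of n] z by (intro mult_right_mono) auto
        then show ?thesis using z by (simp add: power_divide field_simps)
      qed
    qed
    then show False using div by (simp add: rooted_gf_converges_def)
  qed
  then obtain k where k: "1 \<le> real (num_rooted k) * z ^ Suc k" by blast
  \<comment> \<open>For \<open>n \<le> 2 * k + 1\<close> it suffices that a tree exists. Beyond
    that, \<open>n - Suc k\<close> still exceeds \<open>k\<close>, as both the induction hypothesis
    and the distinct weights in \<open>num_rooted_mult_le\<close> require.\<close>
  have "z ^ (2 * k + 1) \<le> real (num_rooted n) * z ^ n" if "k < n" for n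
    using that
  proof (induction n rule: less_induct)
    case (less n)
    show ?case
    proof (cases "n \<le> 2 * k + 1")
      case True
      have "z ^ (2 * k + 1) \<le> z ^ n" using True z by (intro power_decreasing) auto
      also have "\<dots> = 1 * z ^ n" by simp
      also have "\<dots> \<le> real (num_rooted n) * z ^ n"
        using num_rooted_pos[of n] less.prems z by (intro mult_right_mono) auto
      finally show ?thesis .
    next
      case False
      define m where "m = n - Suc k"
      have m: "n = Suc (k + m)" "k < m" "m < n" using False by (auto simp: m_def)
      have "z ^ (2 * k + 1) \<le> real (num_rooted m) * z ^ m" by (rule less.IH[OF m(3,2)])
      also have "\<dots> \<le> (real (num_rooted k) * z ^ Suc k) * (real (num_rooted m) * z ^ m)"
        using mult_right_mono[OF k, of "real (num_rooted m) * z ^ m"] z by simp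
      also have "\<dots> = real (num_rooted k * num_rooted m) * z ^ n"
        by (simp add: m(1) power_add mult_ac)
      also have "\<dots> \<le> real (num_rooted n) * z ^ n"
      proof (rule mult_right_mono)
        show "real (num_rooted k * num_rooted m) \<le> real (num_rooted n)"
          unfolding of_nat_le_iff m(1) using m(2) by (intro num_rooted_mult_le) simp
      qed (use z in simp)
      finally show ?thesis .
    qed
  qed
  then show ?thesis using z by (intro exI[of _ "z ^ (2 * k + 1)"] exI[of _ k]) simp
qed

text \<open>The counting series at \<open>b\<^sup>2\<close> majorizes the terms uniformly on the
  interval, so convergence at \<open>b\<close> itself is not assumed.\<close>

lemma continuous_on_lg_sum:
  assumes "0 < b" "b < 1" "rooted_gf_converges (b\<^sup>2)"
  shows "continuous_on {0..b} lg_sum"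
proof -
  have "uniform_limit {0..b} (\<lambda>N x. \<Sum>n<N. real (num_rooted n) * lg (x ^ n)) lg_sum sequentially"
    unfolding lg_sum_def
  proof (rule Weierstrass_m_test)
    show "summable (\<lambda>n. real (num_rooted n) * (b\<^sup>2) ^ n / (1 - b))"
      using assms(3) unfolding rooted_gf_converges_def by (rule summable_divide)
    fix n x assume x: "x \<in> {0..b}"
    have "norm (real (num_rooted n) * lg (x ^ n)) \<le> real (num_rooted n) * (x\<^sup>2) ^ n / (1 - x)"
      using lg_term_bounds[of x n] x assms by simp
    also have "\<dots> \<le> real (num_rooted n) * (b\<^sup>2) ^ n / (1 - b)"
      using x assms by (intro frac_le mult_left_mono power_mono) auto
    finally show "norm (real (num_rooted n) * lg (x ^ n)) \<le> real (num_rooted n) * (b\<^sup>2) ^ n / (1 - b)" .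
  qed
  moreover have "continuous_on {0..b} (\<lambda>x. real (num_rooted n) * lg (x ^ n))" for n
  proof (cases n)
    case (Suc m)
    have "x ^ n < 1" if "x \<in> {0..b}" for x
      using that assms Suc by (auto simp: power_less_one_iff simp del: power_Suc)
    then show ?thesis unfolding lg_def by (intro continuous_intros) force
  qed simp
  ultimately show ?thesis
    by (intro uniform_limit_theorem[of _ "\<lambda>N x. \<Sum>n<N. real (num_rooted n) * lg (x ^ n)"])
      (auto intro!: always_eventually continuous_on_sum)
qed

text \<open>A forbidden pattern of weight \<open>l\<close> subtracts \<open>x ^ l\<close> from the factor \<open>x / (1 - x)\<close>, which lets the
  bounds of the counting series survive slightly beyond the radius of convergence \<open>\<rho>\<close>.\<close>

lemma avoiding_sum_bounded:
  assumes \<rho>: "0 < \<rho>" "\<rho> < 1" "rooted_gf_converges \<rho>"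
  shows "\<exists>x. \<rho> < x \<and> x < 1 \<and>
    (\<forall>N. wt (Node k0 M0) \<le> N \<longrightarrow> (\<Sum>t \<in> avoiding_upto k0 M0 N. x ^ wt t) \<le> 1)"
proof -
  define l where "l = wt (Node k0 M0)"
  \<comment> \<open>Up to this point \<open>lg_sum\<close> is under control, since
    \<open>b\<^sup>2 = \<rho>\<close>; it lies beyond \<open>\<rho>\<close> because
    \<open>\<rho> < 1\<close>.\<close>
  define b where "b = sqrt \<rho>"
  have b: "b\<^sup>2 = \<rho>" "0 < b" "b < 1" "\<rho> < b"
    using \<rho> by (auto simp: b_def real_less_rsqrt power2_eq_square)
  \<comment> \<open>Bounds the start of the induction at weight \<open>l\<close>. At
    \<open>\<rho>\<close> it is strictly below 1, as the next positive term still fits under the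
    bound.\<close>
  define F where "F x = (\<Sum>n \<le> l. real (num_rooted n) * x ^ n)" for x :: real
  define \<Phi> where "\<Phi> x = (x / (1 - x) - x ^ l) * exp (lg_sum x)" for x :: real
  have "continuous_on {0..b} lg_sum" using b \<rho> by (intro continuous_on_lg_sum) auto
  then have cont: "continuous_on {0..b} \<Phi>" "continuous_on {0..b} F"
    unfolding \<Phi>_def F_def using b by (auto intro!: continuous_intros)
  have "\<rho> \<in> {0<..<b}" using \<rho> b by simp
  then have isCont: "isCont \<Phi> \<rho>" "isCont F \<rho>"
    using continuous_on_interior[OF cont(1)] continuous_on_interior[OF cont(2)] by (simp_all add: interior_atLeastAtMost_real)
  have "\<Phi> \<rho> < \<rho> / (1 - \<rho>) * exp (lg_sum \<rho>)"
    unfolding \<Phi>_def by (rule mult_strict_right_mono) (use \<rho> in auto)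
  also have "\<dots> \<le> exp (- 1)" by (rule rooted_gf_bounds(1)[OF \<rho>])
  finally have \<Phi>_less: "\<Phi> \<rho> < exp (- 1)" .
  have "F \<rho> < F \<rho> + real (num_rooted (Suc l)) * \<rho> ^ Suc l"
    using num_rooted_pos[of "Suc l"] \<rho> by simp
  also have "\<dots> \<le> 1" using rooted_gf_bounds(2)[OF \<rho>, of "Suc l"] by (simp add: F_def)
  finally have F_less: "F \<rho> < 1" .
  have "eventually (\<lambda>x. \<Phi> x < exp (- 1)) (at \<rho>)" "eventually (\<lambda>x. F x < 1) (at \<rho>)"
    using isCont \<Phi>_less F_less by (auto simp: isCont_def intro: order_tendstoD)
  then have "eventually (\<lambda>x. \<Phi> x < exp (- 1) \<and> F x < 1) (at_right \<rho>)"
    by (auto intro: eventually_conj filter_leD[OF at_le] simp: eventually_at_split)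
  moreover have "eventually (\<lambda>x. x \<in> {\<rho><..<b}) (at_right \<rho>)"
    using b by (intro eventually_at_right_real)
  ultimately have "eventually (\<lambda>x. (\<Phi> x < exp (- 1) \<and> F x < 1) \<and> x \<in> {\<rho><..<b}) (at_right \<rho>)"
    by (rule eventually_conj)
  then obtain x where x: "\<Phi> x < exp (- 1)" "F x < 1" "\<rho> < x" "x < b"
    using eventually_happens'[of "at_right \<rho>"] by auto
  have x01: "0 < x" "x < 1" using x \<rho> b by auto
  have "x\<^sup>2 \<le> b\<^sup>2" using x x01 by (intro power_mono) auto
  then have conv2: "rooted_gf_converges (x\<^sup>2)"
    using rooted_gf_converges_mono[OF \<rho>(3), of "x\<^sup>2"] b by simp
  let ?A = "avoiding_upto k0 M0"
  have lg_le: "(\<Sum>t \<in> ?A N. lg (x ^ wt t)) \<le> lg_sum x" for N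
  proof -
    have "0 \<le> lg (x ^ wt t)" for t
      using x01 wt_pos[of t] by (intro lg_nonneg) (auto simp: power_less_one_iff)
    then have "(\<Sum>t \<in> ?A N. lg (x ^ wt t)) \<le> (\<Sum>t \<in> trees_upto N. lg (x ^ wt t))"
      by (intro sum_mono2 finite_wt_le) auto
    also have "\<dots> = (\<Sum>n \<le> N. real (num_rooted n) * lg (x ^ n))"
      by (rule sum_trees_upto[of "\<lambda>n. lg (x ^ n)"])
    also have "\<dots> \<le> lg_sum x"
      unfolding lg_sum_def using lg_term_bounds(1)[of x] x01 conv2
      by (intro sum_le_suminf summable_lg_terms) auto
    finally show ?thesis .
  qed
  have l_pos: "0 < l" unfolding l_def by (rule wt_pos)
  have "x ^ l \<le> x ^ 1" using l_pos x01 by (intro power_decreasing) auto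
  also have "\<dots> \<le> x / (1 - x)" using x01 by (simp add: field_simps)
  finally have fac: "0 \<le> x / (1 - x) - x ^ l" by simp
  have "(\<Sum>t \<in> ?A N. x ^ wt t) \<le> 1" if "l \<le> N" for N
    using that
  proof (induction N rule: dec_induct)
    case base
    have "(\<Sum>t \<in> ?A l. x ^ wt t) \<le> (\<Sum>t \<in> trees_upto l. x ^ wt t)"
      using x01 by (intro sum_mono2 finite_wt_le) auto
    also have "\<dots> = F x" unfolding F_def by (rule sum_trees_upto)
    finally show ?case using x(2) by simp
  next
    case (step N)
    have "(\<Sum>t \<in> ?A (Suc N). x ^ wt t) \<le> (x / (1 - x) - x ^ l) * mset_gf (?A N) x"
      using sum_avoiding_upto_le[OF x01, of k0 M0 N] step.hyps by (simp add: l_def)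
    also have "mset_gf (?A N) x = exp ((\<Sum>t \<in> ?A N. x ^ wt t) + (\<Sum>t \<in> ?A N. lg (x ^ wt t)))"
      by (rule mset_gf_exp[OF finite_avoiding_upto x01])
    also have "(x / (1 - x) - x ^ l) * \<dots> \<le> (x / (1 - x) - x ^ l) * exp (1 + lg_sum x)"
      using step.IH lg_le[of N] fac by (intro mult_left_mono) auto
    also have "\<dots> = \<Phi> x * exp 1" by (simp add: \<Phi>_def exp_add)
    also have "\<dots> \<le> exp (- 1) * exp 1" using x(1) by (intro mult_right_mono) auto
    finally show ?case by (simp add: exp_minus)
  qed
  then show ?thesis using x(3) x01 by (intro exI[of _ x]) (simp add: l_def)
qed

text \<open>With \<rho> < y < z < x, the avoiding trees number at most x^(-n), and divergence at
  \<open>y\<close> gives at least c * z^(-n) rooted trees, both for large n. The linear factor is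
  absorbed by (z / x)^n.\<close>

lemma num_avoiding_negligible:
  "(\<lambda>n. real n * real (num_avoiding k0 M0 n) / real (num_rooted n)) \<longlonglongrightarrow> 0"
proof -
  obtain \<rho> where \<rho>: "0 < \<rho>" "\<rho> < 1" "rooted_gf_converges \<rho>"
    "\<And>z. \<rho> < z \<Longrightarrow> z < 1 \<Longrightarrow> \<not> rooted_gf_converges z"
    using ex_radius by blast
  obtain x where x: "\<rho> < x" "x < 1"
    "\<And>N. wt (Node k0 M0) \<le> N \<Longrightarrow> (\<Sum>t \<in> avoiding_upto k0 M0 N. x ^ wt t) \<le> 1"
    using avoiding_sum_bounded[OF \<rho>(1-3), of k0 M0] by blast
  obtain y where y: "\<rho> < y" "y < x" using dense[OF x(1)] by blast
  obtain z where z: "y < z" "z < x" using dense[OF y(2)] by blast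
  have "0 < y" "z < 1" "\<not> rooted_gf_converges y" using \<rho> x y z by auto
  then obtain c k where c: "0 < c" "\<And>n. k < n \<Longrightarrow> c \<le> real (num_rooted n) * z ^ n"
    using num_rooted_lower[OF _ z(1)] by blast
  have z0: "0 < z" "0 < x" using \<rho> y z by auto
  have avoid: "real (num_avoiding k0 M0 n) * x ^ n \<le> 1" if "wt (Node k0 M0) \<le> n" for n
  proof -
    have "real (num_avoiding k0 M0 n) * x ^ n = (\<Sum>t \<in> {t. wt t = n \<and> \<not> has_pattern k0 M0 t}. x ^ wt t)"
      by (simp add: num_avoiding_def)
    also have "\<dots> \<le> (\<Sum>t \<in> avoiding_upto k0 M0 n. x ^ wt t)"
      using z0 by (intro sum_mono2 finite_avoiding_upto) auto
    also have "\<dots> \<le> 1" by (rule x(3)[OF that])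
    finally show ?thesis .
  qed
  have bound: "real n * real (num_avoiding k0 M0 n) / real (num_rooted n) \<le> (1 / c) * (real n * (z / x) ^ n)"
    if n: "wt (Node k0 M0) \<le> n" "k < n" for n
  proof -
    define a r where "a = real (num_avoiding k0 M0 n)" and "r = real (num_rooted n)"
    have r: "0 < r" using num_rooted_pos[of n] n by (simp add: r_def)
    have "(a * x ^ n) * c \<le> 1 * (r * z ^ n)"
      using avoid[OF n(1)] c(1) c(2)[OF n(2)] by (intro mult_mono) (auto simp: a_def r_def)
    then have "a / r \<le> (1 / c) * (z / x) ^ n"
      using r c(1) z0 by (simp add: power_divide field_simps)
    then have "real n * (a / r) \<le> real n * ((1 / c) * (z / x) ^ n)" by (rule mult_left_mono) simp
    then show ?thesis by (simp add: a_def r_def mult_ac)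
  qed
  have "(\<lambda>n. real n * (z / x) ^ n) \<longlonglongrightarrow> 0"
    using z z0 by (intro powser_times_n_limit_0) simp
  from tendsto_mult[OF tendsto_const this, of "1 / c"]
  have lim: "(\<lambda>n. (1 / c) * (real n * (z / x) ^ n)) \<longlonglongrightarrow> 0" by simp
  show ?thesis
  proof (rule tendsto_sandwich[OF _ _ tendsto_const lim])
    show "\<forall>\<^sub>F n in sequentially. real n * real (num_avoiding k0 M0 n) / real (num_rooted n)
        \<le> (1 / c) * (real n * (z / x) ^ n)"
      using eventually_ge_at_top[of "wt (Node k0 M0)"] eventually_gt_at_top[of k]
      by eventually_elim (rule bound)
  qed (simp add: always_eventually)
qed

theorem corollary3p1:
  fixes L :: "'b weighted_graph" and r :: 'b
  assumes "weighted_rooted_tree L r"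
  shows "limb_proportion L r \<longlonglongrightarrow> 1"
proof -
  have "weighted_tree L" "r \<in> vertices L" using assms by (auto simp: weighted_rooted_tree_def)
  then obtain t where "tree_codes L r t" using ex_tree_code[of L r] by metis
  moreover obtain k0 M0 where "t = Node k0 M0" by (cases t)
  ultimately have "tree_codes L r (Node k0 M0)" by simp
  then show ?thesis
    by (rule limb_proportion_tendsto[OF _ num_rooted_pos num_avoiding_negligible])
qed

end
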